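(* Let $n$ be a positive integer. Then every local derivation on the Lie algebra $W_n^+$ is a derivation of $W_n^+$, and every local derivation on the Lie algebra $W_n^{++}$ is a derivation of $W_n^{++}$.
   Context: All algebras are over $\mathbb{C}$, and $\mathbb{Z}_+$ denotes the set of non-negative integers. $W_n^+=\mathrm{Der}(\mathbb{C}[t_1,\dots,t_n])$ is the Lie algebra of all $\mathbb{C}$-linear derivations of the polynomial algebra $\mathbb{C}[t_1,\dots,t_n]$, with the commutator bracket. Put $d_i=t_i\frac{\partial}{\partial t_i}$, let $\mathfrak{h}$ be the linear span of $d_1,\dots,d_n$, and $t^\alpha=t_1^{\alpha_1}\cdots t_n^{\alpha_n}$. Then $W_n^{++}=\sum_{\alpha\in\mathbb{Z}_+^n}t^\alpha\mathfrak{h}$, a Lie subalgebra of $W_n^+$. A derivation on a Lie algebra $L$ is a linear map $D:L\to L$ with $D([x,y])=[D(x),y]+[x,D(y)]$ for all $x,y\in L$. A local derivation on $L$ is a linear map $\Delta:L\to L$ such that for every $x\in L$ there exists a derivation $D_x:L\to L$ (depending on $x$) with $\Delta(x)=D_x(x)$. *)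

theory Defs
  imports
    Complex_Main
    "HOL-Library.Poly_Mapping"
    "HOL-Library.Function_Algebras"
begin

section \<open>Derivations and local derivations of Lie algebras\<close>

text \<open>
  A Lie algebra is a subspace \<open>L\<close> of an ambient vector space together with a bracket on \<open>L\<close>.
  Maps \<open>L \<rightarrow> L\<close> are represented by functions on the ambient type; only their values on \<open>L\<close>
  are constrained.
\<close>

locale lie_algebra = vector_space scale
  for scale :: "'k::field \<Rightarrow> 'v::ab_group_add \<Rightarrow> 'v" +
  fixes L :: "'v set"
    and bracket :: "'v \<Rightarrow> 'v \<Rightarrow> 'v"
  assumes subspace_L: "subspace L"
    and bracket_closed: "\<lbrakk>x \<in> L; y \<in> L\<rbrakk> \<Longrightarrow> bracket x y \<in> L"
    and bracket_add_left:
      "\<lbrakk>x \<in> L; y \<in> L; z \<in> L\<rbrakk> \<Longrightarrow> bracket (x + y) z = bracket x z + bracket y z"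
    and bracket_add_right:
      "\<lbrakk>x \<in> L; y \<in> L; z \<in> L\<rbrakk> \<Longrightarrow> bracket x (y + z) = bracket x y + bracket x z"
    and bracket_scale_left:
      "\<lbrakk>x \<in> L; y \<in> L\<rbrakk> \<Longrightarrow> bracket (scale c x) y = scale c (bracket x y)"
    and bracket_scale_right:
      "\<lbrakk>x \<in> L; y \<in> L\<rbrakk> \<Longrightarrow> bracket x (scale c y) = scale c (bracket x y)"
    and bracket_self: "x \<in> L \<Longrightarrow> bracket x x = 0"
    and jacobi: "\<lbrakk>x \<in> L; y \<in> L; z \<in> L\<rbrakk> \<Longrightarrow>
      bracket x (bracket y z) + bracket y (bracket z x) + bracket z (bracket x y) = 0"
begin

definition linear_endo :: "('v \<Rightarrow> 'v) \<Rightarrow> bool" where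
  "linear_endo D \<longleftrightarrow>
     (\<forall>x\<in>L. D x \<in> L) \<and>
     (\<forall>x\<in>L. \<forall>y\<in>L. D (x + y) = D x + D y) \<and>
     (\<forall>c. \<forall>x\<in>L. D (scale c x) = scale c (D x))"

definition derivation :: "('v \<Rightarrow> 'v) \<Rightarrow> bool" where
  "derivation D \<longleftrightarrow> linear_endo D \<and>
     (\<forall>x\<in>L. \<forall>y\<in>L. D (bracket x y) = bracket (D x) y + bracket x (D y))"

definition local_derivation :: "('v \<Rightarrow> 'v) \<Rightarrow> bool" where
  "local_derivation \<Delta> \<longleftrightarrow> linear_endo \<Delta> \<and>
     (\<forall>x\<in>L. \<exists>D. derivation D \<and> \<Delta> x = D x)"

end


section \<open>The polynomial algebra and its derivations\<close>

text \<open>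
  The finite type \<open>'n\<close> indexes the variables, so \<open>n = CARD('n) \<ge> 1\<close>. A multi-exponent in
  \<open>\<int>\<^sub>+\<^sup>n\<close> is an element of \<open>'n \<Rightarrow>\<^sub>0 nat\<close>, and the multiplication of \<^typ>\<open>('n \<Rightarrow>\<^sub>0 nat) \<Rightarrow>\<^sub>0 complex\<close>
  is the convolution product, i.e. the usual product of polynomials.
\<close>

type_synonym 'n cpoly = "('n \<Rightarrow>\<^sub>0 nat) \<Rightarrow>\<^sub>0 complex"

definition monomial :: "('n::finite \<Rightarrow>\<^sub>0 nat) \<Rightarrow> 'n cpoly" where
  "monomial \<alpha> = Poly_Mapping.single \<alpha> 1"

definition unit_exp :: "'n::finite \<Rightarrow> 'n \<Rightarrow>\<^sub>0 nat" where
  "unit_exp i = Poly_Mapping.single i 1"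

definition var :: "'n::finite \<Rightarrow> 'n cpoly" where
  "var i = monomial (unit_exp i)"

definition pscale :: "complex \<Rightarrow> 'n::finite cpoly \<Rightarrow> 'n cpoly" where
  "pscale c p = Poly_Mapping.single 0 c * p"

text \<open>
  Exponents are subtracted in \<open>nat\<close>; where this truncates (\<open>\<alpha>\<^sub>i = 0\<close>) the coefficient vanishes.
\<close>

definition partial :: "'n::finite \<Rightarrow> 'n cpoly \<Rightarrow> 'n cpoly" where
  "partial i p = (\<Sum>\<alpha>\<in>Poly_Mapping.keys p.
     Poly_Mapping.single (\<alpha> - unit_exp i) (of_nat (Poly_Mapping.lookup \<alpha> i) * Poly_Mapping.lookup p \<alpha>))"

type_synonym 'n poly_op = "'n cpoly \<Rightarrow> 'n cpoly"

text \<open>Operators are added pointwise, as provided by \<^theory>\<open>HOL-Library.Function_Algebras\<close>.\<close>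

definition op_scale :: "complex \<Rightarrow> 'n::finite poly_op \<Rightarrow> 'n poly_op" where
  "op_scale c D = (\<lambda>p. pscale c (D p))"

definition poly_act :: "'n::finite cpoly \<Rightarrow> 'n poly_op \<Rightarrow> 'n poly_op" where
  "poly_act f D = (\<lambda>p. f * D p)"

definition commutator :: "'n::finite poly_op \<Rightarrow> 'n poly_op \<Rightarrow> 'n poly_op" where
  "commutator D E = (\<lambda>p. D (E p) - E (D p))"

definition W_plus :: "'n::finite poly_op set" where
  "W_plus = {D. Vector_Spaces.linear pscale pscale D \<and> (\<forall>p q. D (p * q) = D p * q + p * D q)}"

definition euler :: "'n::finite \<Rightarrow> 'n poly_op" where
  "euler i = poly_act (var i) (partial i)"

lemma vector_space_pscale: "vector_space pscale"
  by unfold_locales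
     (simp_all add: pscale_def single_add distrib_left distrib_right mult_single
        flip: mult.assoc)

global_interpretation op: vector_space op_scale
  using vector_space_pscale
  by (auto simp: vector_space_def op_scale_def fun_eq_iff)

definition cartan :: "'n::finite poly_op set" where
  "cartan = op.span (range euler)"

definition W_plus_plus :: "'n::finite poly_op set" where
  "W_plus_plus = op.span (\<Union>\<alpha>. poly_act (monomial \<alpha>) ` cartan)"


section \<open>Both are Lie algebras under the commutator\<close>

lemma W_plusI:
  assumes "\<And>p q. D (p + q) = D p + D q" "\<And>c p. D (pscale c p) = pscale c (D p)"
    "\<And>p q. D (p * q) = D p * q + p * D q"
  shows "D \<in> W_plus"
  using assms vector_space_pscale
  by (auto simp: W_plus_def Vector_Spaces.linear_def module_hom_def module_hom_axioms_def
      vector_space_def module_def)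

lemma
  assumes "D \<in> W_plus"
  shows W_plus_add: "D (p + q) = D p + D q"
    and W_plus_scale: "D (pscale c p) = pscale c (D p)"
    and W_plus_mult: "D (p * q) = D p * q + p * D q"
  using assms
  by (auto simp: W_plus_def Vector_Spaces.linear_def module_hom_def module_hom_axioms_def)

lemma W_plus_zero: "D \<in> W_plus \<Longrightarrow> D 0 = 0"
  using W_plus_add[of D 0 0] by simp

lemma W_plus_diff:
  assumes "D \<in> W_plus"
  shows "D (p - q) = D p - D q"
  using W_plus_add[OF assms, of "p - q" q] by (simp add: algebra_simps)

lemma pscale_add: "pscale c (p + q) = pscale c p + pscale c q"
  by (simp add: pscale_def algebra_simps)

lemma pscale_diff: "pscale c (p - q) = pscale c p - pscale c q"
  by (simp add: pscale_def algebra_simps)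

lemma pscale_commute: "pscale a (pscale b p) = pscale b (pscale a p)"
  by (simp add: pscale_def algebra_simps)

lemma subspace_W_plus: "op.subspace W_plus"
proof (rule op.subspaceI)
  show "op_scale c D \<in> W_plus" if "D \<in> W_plus" for c D
  proof (rule W_plusI)
    show "op_scale c D (pscale a p) = pscale a (op_scale c D p)" for a p
      using that by (simp add: op_scale_def W_plus_scale) (rule pscale_commute)
    show "op_scale c D (p * q) = op_scale c D p * q + p * op_scale c D q" for p q
      using that
      by (simp add: op_scale_def W_plus_mult pscale_add) (simp add: pscale_def algebra_simps)
  qed (use that in \<open>simp add: op_scale_def W_plus_add pscale_add\<close>)
next
  show "0 \<in> W_plus"
    by (rule W_plusI) (simp_all add: pscale_def)
  show "D + E \<in> W_plus" if "D \<in> W_plus" "E \<in> W_plus" for D E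
    by (rule W_plusI) (use that in \<open>simp_all add: W_plus_add W_plus_scale W_plus_mult pscale_add algebra_simps\<close>)
qed

lemma commutator_in_W_plus: "\<lbrakk>D \<in> W_plus; E \<in> W_plus\<rbrakk> \<Longrightarrow> commutator D E \<in> W_plus"
  by (rule W_plusI)
     (simp_all add: commutator_def W_plus_add W_plus_scale W_plus_mult pscale_diff algebra_simps)

lemma lie_algebra_subset_W_plus:
  assumes "op.subspace L" "L \<subseteq> W_plus" "\<And>D E. \<lbrakk>D \<in> L; E \<in> L\<rbrakk> \<Longrightarrow> commutator D E \<in> L"
  shows "lie_algebra op_scale L commutator"
proof -
  have sub: "D \<in> W_plus" if "D \<in> L" for D
    using that assms(2) by blast
  show ?thesis
    by unfold_locales
       (use assms(1,3) in \<open>auto simp: commutator_def op_scale_def fun_eq_iff pscale_diff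
          W_plus_add W_plus_diff W_plus_scale W_plus_zero dest!: sub\<close>)
qed

lemma poly_act_in_W_plus:
  assumes "D \<in> W_plus"
  shows "poly_act f D \<in> W_plus"
proof (rule W_plusI)
  show "poly_act f D (pscale c p) = pscale c (poly_act f D p)" for c p
    by (simp add: poly_act_def W_plus_scale[OF assms]) (simp add: pscale_def algebra_simps)
qed (simp_all add: poly_act_def W_plus_add[OF assms] W_plus_mult[OF assms] algebra_simps)

lemma cpoly_induct [case_names zero add single]:
  fixes p :: "'n::finite cpoly"
  assumes "P 0" "\<And>p q. P p \<Longrightarrow> P q \<Longrightarrow> P (p + q)" "\<And>\<alpha> c. P (Poly_Mapping.single \<alpha> c)"
  shows "P p"
proof (induction p rule: update_induct)
  case const
  then show ?case by (rule assms(1))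
next
  case (update f a b)
  have "Poly_Mapping.update a b f = f + Poly_Mapping.single a b"
    using update.hyps
    by (intro poly_mapping_eqI) (auto simp: lookup_update lookup_add lookup_single when_def in_keys_iff)
  then show ?case
    using assms(2,3) update.IH by simp
qed

lemma partial_superset:
  assumes "finite A" "Poly_Mapping.keys p \<subseteq> A"
  shows "partial i p = (\<Sum>\<alpha>\<in>A.
     Poly_Mapping.single (\<alpha> - unit_exp i) (of_nat (Poly_Mapping.lookup \<alpha> i) * Poly_Mapping.lookup p \<alpha>))"
  unfolding partial_def
  by (rule sum.mono_neutral_left) (use assms in \<open>auto simp: in_keys_iff\<close>)

lemma partial_add: "partial i (p + q) = partial i p + partial i q"
proof -
  let ?A = "Poly_Mapping.keys p \<union> Poly_Mapping.keys q"
  have "Poly_Mapping.keys (p + q) \<subseteq> ?A"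
    by (rule Poly_Mapping.keys_add)
  then show ?thesis
    by (simp add: partial_superset[of ?A] lookup_add distrib_left single_add sum.distrib)
qed

lemma partial_single:
  "partial i (Poly_Mapping.single \<alpha> c) =
     Poly_Mapping.single (\<alpha> - unit_exp i) (of_nat (Poly_Mapping.lookup \<alpha> i) * c)"
  by (subst partial_superset[of "{\<alpha>}"]) auto

lemma partial_zero: "partial i 0 = 0"
  by (simp add: partial_def)

lemma exp_diff_add:
  assumes "Poly_Mapping.lookup \<alpha> i \<noteq> 0"
  shows "\<alpha> - unit_exp i + \<beta> = \<alpha> + \<beta> - unit_exp i"
proof (rule poly_mapping_eqI)
  show "Poly_Mapping.lookup (\<alpha> - unit_exp i + \<beta>) k = Poly_Mapping.lookup (\<alpha> + \<beta> - unit_exp i) k" for k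
    using assms
    by (cases "k = i") (auto simp: lookup_add lookup_minus unit_exp_def lookup_single)
qed

lemma partial_mult_single:
  "partial i (Poly_Mapping.single \<alpha> a * Poly_Mapping.single \<beta> b) =
     partial i (Poly_Mapping.single \<alpha> a) * Poly_Mapping.single \<beta> b +
     Poly_Mapping.single \<alpha> a * partial i (Poly_Mapping.single \<beta> b)"
proof -
  have 1: "partial i (Poly_Mapping.single \<alpha> a) * Poly_Mapping.single \<beta> b =
     Poly_Mapping.single (\<alpha> + \<beta> - unit_exp i) (of_nat (Poly_Mapping.lookup \<alpha> i) * a * b)"
    using exp_diff_add[of \<alpha> i \<beta>] by (cases "Poly_Mapping.lookup \<alpha> i = 0") (auto simp: partial_single mult_single)
  have 2: "Poly_Mapping.single \<alpha> a * partial i (Poly_Mapping.single \<beta> b) =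
     Poly_Mapping.single (\<alpha> + \<beta> - unit_exp i) (of_nat (Poly_Mapping.lookup \<beta> i) * a * b)"
    using exp_diff_add[of \<beta> i \<alpha>]
    by (cases "Poly_Mapping.lookup \<beta> i = 0") (auto simp: partial_single mult_single add.commute mult_ac)
  show ?thesis
    unfolding 1 2
    by (simp add: mult_single partial_single lookup_add algebra_simps flip: single_add)
qed

lemma partial_mult: "partial i (p * q) = partial i p * q + p * partial i q"
proof (induction p rule: cpoly_induct)
  case (single \<alpha> c)
  show ?case
    by (induction q rule: cpoly_induct)
       (simp_all add: partial_zero partial_add partial_mult_single algebra_simps)
qed (simp_all add: partial_zero partial_add algebra_simps)

lemma partial_in_W_plus: "partial i \<in> W_plus"
  by (rule W_plusI)
     (simp_all add: partial_add partial_mult pscale_def partial_single)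

lemma euler_in_W_plus: "euler i \<in> W_plus"
  unfolding euler_def by (intro poly_act_in_W_plus partial_in_W_plus)

lemma euler_single:
  "euler i (Poly_Mapping.single \<alpha> c) = Poly_Mapping.single \<alpha> (of_nat (Poly_Mapping.lookup \<alpha> i) * c)"
proof (cases "Poly_Mapping.lookup \<alpha> i = 0")
  case False
  then show ?thesis
    using exp_diff_add[of \<alpha> i "unit_exp i"]
    by (simp add: euler_def poly_act_def var_def monomial_def partial_single mult_single add.commute)
qed (simp add: euler_def poly_act_def partial_single)

lemma euler_commute: "euler i (euler j p) = euler j (euler i p)"
  by (induction p rule: cpoly_induct)
     (simp_all add: euler_single W_plus_zero W_plus_add euler_in_W_plus mult_ac)

lemma W_plus_plus_subset: "W_plus_plus \<subseteq> W_plus"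
proof -
  have "cartan \<subseteq> W_plus"
    unfolding cartan_def
    by (rule op.span_minimal) (auto simp: euler_in_W_plus subspace_W_plus)
  then show ?thesis
    unfolding W_plus_plus_def
    by (intro op.span_minimal) (auto simp: subspace_W_plus poly_act_in_W_plus)
qed

lemma subspace_W_plus_plus: "op.subspace W_plus_plus"
  by (simp add: W_plus_plus_def)

lemma poly_act_euler_in: "poly_act f (euler i) \<in> W_plus_plus"
proof (induction f rule: cpoly_induct)
  case zero
  have "poly_act 0 (euler i) = 0"
    by (simp add: poly_act_def fun_eq_iff)
  then show ?case
    by (simp only: op.subspace_0[OF subspace_W_plus_plus])
next
  case (add p q)
  have "poly_act (p + q) (euler i) = poly_act p (euler i) + poly_act q (euler i)"
    by (simp add: poly_act_def fun_eq_iff distrib_right)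
  then show ?case
    using op.subspace_add[OF subspace_W_plus_plus add] by (simp only:)
next
  case (single \<alpha> c)
  have eq: "poly_act (Poly_Mapping.single \<alpha> c) (euler i) =
      op_scale c (poly_act (monomial \<alpha>) (euler i))"
    by (simp add: poly_act_def op_scale_def monomial_def pscale_def fun_eq_iff mult_single
        flip: mult.assoc)
  have "poly_act (monomial \<alpha>) (euler i) \<in> W_plus_plus"
    unfolding W_plus_plus_def
    by (intro op.span_base UN_I[of \<alpha>] imageI) (auto simp: cartan_def intro: op.span_base)
  then show ?case
    unfolding eq by (rule op.subspace_scale[OF subspace_W_plus_plus])
qed

lemma W_plus_plus_span:
  "(W_plus_plus :: 'n::finite poly_op set) = op.span {poly_act f (euler i) | f i. True}" (is "_ = op.span ?S")
proof
  have *: "poly_act (monomial \<alpha>) h \<in> op.span ?S" if "h \<in> cartan" for \<alpha> h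
    using that unfolding cartan_def
  proof (induction rule: op.span_induct_alt)
    case base
    have "poly_act (monomial \<alpha>) 0 = 0"
      by (simp add: poly_act_def fun_eq_iff)
    then show ?case by (simp only: op.span_zero)
  next
    case (step c x y)
    have eq: "poly_act (monomial \<alpha>) (op_scale c x + y) =
        op_scale c (poly_act (monomial \<alpha>) x) + poly_act (monomial \<alpha>) y"
      by (simp add: poly_act_def op_scale_def pscale_def fun_eq_iff algebra_simps)
    show ?case
      unfolding eq using step by (intro op.span_add op.span_scale) (auto intro: op.span_base)
  qed
  show "W_plus_plus \<subseteq> op.span ?S"
    unfolding W_plus_plus_def
    by (rule op.span_minimal) (use * in blast, rule op.subspace_span)
  show "op.span ?S \<subseteq> W_plus_plus"
    by (rule op.span_minimal) (auto simp: poly_act_euler_in subspace_W_plus_plus)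
qed

lemma commutator_euler:
  "commutator (poly_act f (euler i)) (poly_act g (euler j)) =
     poly_act (f * euler i g) (euler j) - poly_act (g * euler j f) (euler i)"
  by (simp add: commutator_def poly_act_def fun_eq_iff fun_diff_def W_plus_mult[OF euler_in_W_plus]
      euler_commute[of i j] algebra_simps)

lemma commutator_in_W_plus_plus:
  fixes D E :: "'n::finite poly_op"
  assumes "D \<in> W_plus_plus" "E \<in> W_plus_plus"
  shows "commutator D E \<in> W_plus_plus"
proof -
  note ss = subspace_W_plus_plus
  let ?S = "{poly_act f (euler i) | f (i::'n). True}"
  have SW: "x \<in> W_plus" if "x \<in> ?S" for x
    using that poly_act_in_W_plus[OF euler_in_W_plus] by blast
  have gen: "commutator x E \<in> W_plus_plus" if x: "x \<in> ?S" for x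
    using assms(2) unfolding W_plus_plus_span[where 'n = 'n]
  proof (induction rule: op.span_induct_alt)
    case base
    have "commutator x 0 = 0"
      by (simp add: commutator_def fun_eq_iff W_plus_zero[OF SW[OF x]])
    then show ?case by (simp only: op.span_zero)
  next
    case (step c y z)
    have eq: "commutator x (op_scale c y + z) = op_scale c (commutator x y) + commutator x z"
      by (simp add: commutator_def op_scale_def fun_eq_iff W_plus_add[OF SW[OF x]]
          W_plus_scale[OF SW[OF x]] pscale_diff)
    have "commutator x y \<in> W_plus_plus"
      using x step(1)
      by (auto simp: commutator_euler intro!: op.subspace_diff[OF ss] poly_act_euler_in)
    then show ?case
      unfolding eq using step
      by (intro op.span_add op.span_scale) (auto simp: W_plus_plus_span)
  qed
  have EW: "E \<in> W_plus"
    using assms(2) W_plus_plus_subset by blast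
  have "commutator D E \<in> op.span ?S"
    using assms(1) unfolding W_plus_plus_span[where 'n = 'n]
  proof (induction rule: op.span_induct_alt)
    case base
    have "commutator 0 E = 0"
      by (simp add: commutator_def fun_eq_iff W_plus_zero[OF EW])
    then show ?case by (simp only: op.span_zero)
  next
    case (step c y z)
    have eq: "commutator (op_scale c y + z) E = op_scale c (commutator y E) + commutator z E"
      by (simp add: commutator_def op_scale_def fun_eq_iff W_plus_add[OF EW]
          W_plus_scale[OF EW] pscale_diff)
    show ?case
      unfolding eq using step gen[OF step(1)]
      by (intro op.span_add op.span_scale) (auto simp: W_plus_plus_span)
  qed
  then show ?thesis
    by (simp add: W_plus_plus_span)
qed

global_interpretation W_plus: lie_algebra op_scale W_plus commutator
  by (intro lie_algebra_subset_W_plus subspace_W_plus commutator_in_W_plus subset_refl)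

global_interpretation W_plus_plus: lie_algebra op_scale W_plus_plus commutator
  by (intro lie_algebra_subset_W_plus subspace_W_plus_plus W_plus_plus_subset
      commutator_in_W_plus_plus)

end

theory Submission
  imports Defs
begin

text \<open>
  Both algebras consist of the vector fields \<open>\<Sum>\<^sub>i F\<^sub>i \<delta>\<^sub>i\<close> with polynomial coefficients for a commuting
  frame \<open>\<delta>\<close>: the partial derivatives for \<open>W\<^sub>n\<^sup>+\<close>, the Euler operators \<open>t\<^sub>i \<partial>\<^sub>i\<close> for \<open>W\<^sub>n\<^sup>+\<^sup>+\<close>. All their
  derivations are inner, so a local derivation \<open>T\<close> satisfies \<open>T F = [Y, F]\<close> with \<open>Y\<close> depending on \<open>F\<close>.
  At a point \<open>p\<close> of the torus, \<open>[Y, F](p) = 0\<close> whenever the 1-jet of \<open>F\<close> at \<open>p\<close> is zero, so \<open>T\<close> is a first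
  order differential operator. Fields with \<open>F(p) = 0\<close> and linear part \<open>J\<close> have \<open>[Y, F](p) \<in> im J\<close>, and
  \<open>J\<close> of rank one gives that \<open>T\<close> has the same first-order part as \<open>[b, \<cdot>]\<close> for some \<open>b\<close>. The difference
  is multiplication by a matrix \<open>A\<close>, and for invertible \<open>J\<close> a trace argument gives \<open>tr (A(p) J) = 0\<close>;
  hence \<open>A = 0\<close>.
\<close>

section \<open>Evaluation of polynomials\<close>

definition at_point :: "('n::finite \<Rightarrow> complex) \<Rightarrow> 'n cpoly \<Rightarrow> complex" where
  "at_point p f = (\<Sum>\<alpha>\<in>Poly_Mapping.keys f.
     Poly_Mapping.lookup f \<alpha> * (\<Prod>i\<in>UNIV. p i ^ Poly_Mapping.lookup \<alpha> i))"

lemma at_point_superset: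
  assumes "finite A" "Poly_Mapping.keys f \<subseteq> A"
  shows "at_point p f = (\<Sum>\<alpha>\<in>A.
     Poly_Mapping.lookup f \<alpha> * (\<Prod>i\<in>UNIV. p i ^ Poly_Mapping.lookup \<alpha> i))"
  unfolding at_point_def
  by (rule sum.mono_neutral_left) (use assms in \<open>auto simp: in_keys_iff\<close>)

lemma at_point_single:
  "at_point p (Poly_Mapping.single \<alpha> c) = c * (\<Prod>i\<in>UNIV. p i ^ Poly_Mapping.lookup \<alpha> i)"
  by (subst at_point_superset[of "{\<alpha>}"]) auto

lemma at_point_zero [simp]: "at_point p 0 = 0"
  by (simp add: at_point_def)

lemma at_point_one [simp]: "at_point p 1 = 1"
  using at_point_single[of p 0 1] by simp

lemma at_point_add: "at_point p (f + g) = at_point p f + at_point p g"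
proof -
  let ?A = "Poly_Mapping.keys f \<union> Poly_Mapping.keys g"
  have "Poly_Mapping.keys (f + g) \<subseteq> ?A"
    by (rule Poly_Mapping.keys_add)
  then show ?thesis
    by (simp add: at_point_superset[of ?A] lookup_add distrib_right sum.distrib)
qed

lemma at_point_diff: "at_point p (f - g) = at_point p f - at_point p g"
  using at_point_add[of p "f - g" g] by simp

lemma at_point_sum: "at_point p (sum f A) = (\<Sum>i\<in>A. at_point p (f i))"
  by (induction A rule: infinite_finite_induct) (simp_all add: at_point_add)

lemma at_point_mult: "at_point p (f * g) = at_point p f * at_point p g"
proof (induction f rule: cpoly_induct)
  case (single \<alpha> c)
  show ?case
    by (induction g rule: cpoly_induct)
       (simp_all add: at_point_single mult_single at_point_add lookup_add power_add
          prod.distrib algebra_simps)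
qed (simp_all add: at_point_add algebra_simps)

lemma at_point_pscale: "at_point p (pscale c f) = c * at_point p f"
  by (simp add: pscale_def at_point_mult at_point_single)

lemma at_point_var [simp]: "at_point p (var i) = p i"
proof -
  have "(\<Prod>k\<in>UNIV. p k ^ Poly_Mapping.lookup (unit_exp i) k) =
      (\<Prod>k\<in>UNIV. if k = i then p i else 1)"
    by (rule prod.cong) (auto simp: unit_exp_def lookup_single)
  then show ?thesis
    by (simp add: var_def monomial_def at_point_single)
qed

text \<open>
  Linear independence of characters of the torus: comparing \<open>f\<close> with its image under scaling one
  variable by 2 removes a monomial.
\<close>

lemma zero_if_at_torus_zero:
  fixes f :: "'n::finite cpoly"
  assumes "\<And>p. (\<And>i. p i \<noteq> 0) \<Longrightarrow> at_point p f = 0"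
  shows "f = 0"
  using assms
proof (induction "card (Poly_Mapping.keys f)" arbitrary: f rule: less_induct)
  case less
  show ?case
  proof (rule ccontr)
    assume "f \<noteq> 0"
    then obtain \<alpha> where \<alpha>: "\<alpha> \<in> Poly_Mapping.keys f"
      by (metis all_not_in_conv keys_eq_empty)
    show False
    proof (cases "Poly_Mapping.keys f = {\<alpha>}")
      case True
      have "at_point (\<lambda>_. 1) f = Poly_Mapping.lookup f \<alpha>"
        by (simp add: at_point_def True)
      then show False
        using less.prems[of "\<lambda>_. 1"] \<alpha> by (simp add: in_keys_iff)
    next
      case False
      then obtain \<beta> where \<beta>: "\<beta> \<in> Poly_Mapping.keys f" "\<beta> \<noteq> \<alpha>"
        using \<alpha> by blast
      then obtain i where i: "Poly_Mapping.lookup \<beta> i \<noteq> Poly_Mapping.lookup \<alpha> i"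
        by (meson poly_mapping_eqI)
      define c where "c \<gamma> = (2::complex) ^ Poly_Mapping.lookup \<gamma> i - 2 ^ Poly_Mapping.lookup \<alpha> i" for \<gamma>
      define g where "g = Poly_Mapping.mapp (\<lambda>\<gamma> x. c \<gamma> * x) f"
      have lg: "Poly_Mapping.lookup g \<gamma> = c \<gamma> * Poly_Mapping.lookup f \<gamma>" for \<gamma>
        by (auto simp: g_def lookup_mapp in_keys_iff when_def)
      have sub: "Poly_Mapping.keys g \<subseteq> Poly_Mapping.keys f - {\<alpha>}"
        by (auto simp: in_keys_iff lg c_def)
      have "at_point p g = 0" if p: "\<And>i. p i \<noteq> 0" for p
      proof -
        have pr: "(\<Prod>k\<in>UNIV. (p(i := 2 * p i)) k ^ Poly_Mapping.lookup \<gamma> k) =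
            2 ^ Poly_Mapping.lookup \<gamma> i * (\<Prod>k\<in>UNIV. p k ^ Poly_Mapping.lookup \<gamma> k)" for \<gamma>
          by (simp add: prod.remove[of UNIV i] power_mult_distrib)
        have "at_point p g = at_point (p(i := 2 * p i)) f - 2 ^ Poly_Mapping.lookup \<alpha> i * at_point p f"
          unfolding at_point_superset[OF finite_keys subset_trans[OF sub Diff_subset]] lg
          unfolding at_point_def pr c_def
          by (simp add: sum_distrib_left algebra_simps flip: sum_subtractf)
        also have "\<dots> = 0"
          using less.prems[of p] less.prems[of "p(i := 2 * p i)"] p by auto
        finally show ?thesis .
      qed
      moreover have "card (Poly_Mapping.keys g) < card (Poly_Mapping.keys f)"
        by (rule psubset_card_mono) (use sub \<alpha> in auto)
      ultimately have "g = 0"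
        using less.hyps by blast
      moreover have "c \<beta> \<noteq> 0"
      proof
        assume "c \<beta> = 0"
        \<comment> \<open>Norms carry the equation to powers of the real number 2, which determine
          their exponents.\<close>
        then have "norm ((2::complex) ^ Poly_Mapping.lookup \<beta> i) = norm ((2::complex) ^ Poly_Mapping.lookup \<alpha> i)"
          by (simp add: c_def)
        then show False
          using i by (simp add: norm_power)
      qed
      ultimately show False
        using lg[of \<beta>] \<beta> by (simp add: in_keys_iff)
    qed
  qed
qed

lemma eq_if_at_torus_eq:
  assumes "\<And>p. (\<And>i. p i \<noteq> 0) \<Longrightarrow> at_point p f = at_point p g"
  shows "f = g"
  using zero_if_at_torus_zero[of "f - g"] assms by (simp add: at_point_diff)

section \<open>Vector fields with respect to a commuting frame\<close>

lemma W_plus_one: "D \<in> W_plus \<Longrightarrow> D 1 = 0"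
  using W_plus_mult[of D 1 1] by simp

lemma W_plus_sum: "D \<in> W_plus \<Longrightarrow> D (sum f A) = (\<Sum>i\<in>A. D (f i))"
  by (induction A rule: infinite_finite_induct) (simp_all add: W_plus_zero W_plus_add)

section \<open>Coefficient vectors and linear maps on them\<close>

definition along :: "'n::finite \<Rightarrow> 'n cpoly \<Rightarrow> 'n \<Rightarrow> 'n cpoly" where
  "along j f = (\<lambda>k. if k = j then f else 0)"

lemma along_add: "along j (f + g) = along j f + along j g"
  by (simp add: along_def fun_eq_iff)

lemma sum_fun_apply: "sum F A k = (\<Sum>j\<in>A. F j k)"
  by (induction A rule: infinite_finite_induct) auto

lemma sum_along: "(\<Sum>j\<in>UNIV. along j (F j)) = F"
  by (rule ext) (simp add: sum_fun_apply along_def)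

definition lin :: "(('n::finite \<Rightarrow> 'n cpoly) \<Rightarrow> 'n \<Rightarrow> 'n cpoly) \<Rightarrow> bool" where
  "lin T \<longleftrightarrow> (\<forall>F G. T (F + G) = T F + T G) \<and>
     (\<forall>c F. T (\<lambda>i. pscale c (F i)) = (\<lambda>i. pscale c (T F i)))"

lemma
  assumes "lin T"
  shows lin_add: "T (F + G) = T F + T G"
    and lin_scale: "T (\<lambda>i. pscale c (F i)) = (\<lambda>i. pscale c (T F i))"
  using assms by (simp_all add: lin_def)

lemma lin_zero: "lin T \<Longrightarrow> T 0 = 0"
  using lin_add[of T 0 0] by simp

lemma lin_diff: "lin T \<Longrightarrow> T (F - G) = T F - T G"
  using lin_add[of T "F - G" G] by (simp add: algebra_simps)

lemma lin_sum: "lin T \<Longrightarrow> T (sum F A) k = (\<Sum>i\<in>A. T (F i) k)"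
  by (induction A rule: infinite_finite_induct) (simp_all add: lin_zero lin_add)

lemma lin_along_add: "lin T \<Longrightarrow> T (along j (f + g)) k = T (along j f) k + T (along j g) k"
  by (simp add: along_add lin_add)

lemma pscale_zero [simp]: "pscale c 0 = 0"
  by (simp add: pscale_def)

lemma lin_along_pscale: "lin T \<Longrightarrow> T (along j (pscale c f)) k = pscale c (T (along j f) k)"
proof -
  have "along j (pscale c f) = (\<lambda>i. pscale c (along j f i))"
    by (simp add: along_def fun_eq_iff)
  then show "lin T \<Longrightarrow> ?thesis"
    by (simp add: lin_scale)
qed

lemma lin_along_zero: "lin T \<Longrightarrow> T (along j 0) k = 0"
  using lin_along_add[of T j 0 0] by simp

lemma lin_along_sum: "lin T \<Longrightarrow> T (along j (sum f A)) k = (\<Sum>i\<in>A. T (along j (f i)) k)"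
  by (induction A rule: infinite_finite_induct) (simp_all add: lin_along_zero lin_along_add)

lemma lin_decompose: "lin T \<Longrightarrow> T F k = (\<Sum>j\<in>UNIV. T (along j (F j)) k)"
  using lin_sum[of T "\<lambda>j. along j (F j)" UNIV] by (simp add: sum_along)

text \<open>One setting for both algebras: \<open>w i\<close> is 1 for the partial derivatives and
  \<open>var i\<close> for the Euler operators. As the weights do not vanish on the torus, the frame
  spans the tangent space at each torus point; \<open>weight_dvd\<close> keeps the first-order
  coefficients of a locally inner map polynomial.\<close>

locale commuting_frame =
  fixes \<delta> :: "'n::finite \<Rightarrow> 'n poly_op" and w :: "'n \<Rightarrow> 'n cpoly"
  assumes frame_in_W_plus: "\<delta> i \<in> W_plus"
    and frame_commute: "\<delta> i (\<delta> j f) = \<delta> j (\<delta> i f)"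
    and frame_var: "\<delta> i (var j) = (if i = j then w i else 0)"
    and weight_dvd: "w i dvd var i"
    and weight_torus: "(\<And>j. p j \<noteq> 0) \<Longrightarrow> at_point p (w i) \<noteq> 0"
begin

lemmas frame_add = W_plus_add[OF frame_in_W_plus]
  and frame_diff = W_plus_diff[OF frame_in_W_plus]
  and frame_pscale = W_plus_scale[OF frame_in_W_plus]
  and frame_mult = W_plus_mult[OF frame_in_W_plus]
  and frame_zero = W_plus_zero[OF frame_in_W_plus]
  and frame_one = W_plus_one[OF frame_in_W_plus]
  and frame_sum = W_plus_sum[OF frame_in_W_plus]

text \<open>Coordinates of the commutator of two fields; there are no terms with brackets of the
  frame because the frame commutes.\<close>

definition br :: "('n \<Rightarrow> 'n cpoly) \<Rightarrow> ('n \<Rightarrow> 'n cpoly) \<Rightarrow> 'n \<Rightarrow> 'n cpoly" where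
  "br Y F = (\<lambda>j. \<Sum>i\<in>UNIV. Y i * \<delta> i (F j) - F i * \<delta> i (Y j))"

definition vector_field :: "('n \<Rightarrow> 'n cpoly) \<Rightarrow> 'n poly_op" where
  "vector_field F = (\<lambda>f. \<Sum>i\<in>UNIV. F i * \<delta> i f)"

lemma vector_field_in_W_plus: "vector_field F \<in> W_plus"
proof (rule W_plusI)
  show "vector_field F (pscale c f) = pscale c (vector_field F f)" for c f
    unfolding vector_field_def frame_pscale by (simp add: pscale_def sum_distrib_left mult_ac)
qed (simp_all add: vector_field_def frame_add frame_mult distrib_left sum.distrib
    sum_distrib_left sum_distrib_right mult_ac)

lemma vector_field_var: "vector_field F (var j) = F j * w j"
proof -
  have "F i * (if i = j then w i else 0) = (if i = j then F j * w j else 0)" for i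
    by simp
  then show ?thesis
    by (simp add: vector_field_def frame_var)
qed

text \<open>The weight can be divided out at each torus point, and values on the torus determine a
  polynomial.\<close>

lemma weight_cancel:
  assumes "f * w j = g * w j"
  shows "f = g"
proof (rule eq_if_at_torus_eq)
  fix p :: "'n \<Rightarrow> complex"
  assume p: "\<And>i. p i \<noteq> 0"
  have "at_point p f * at_point p (w j) = at_point p g * at_point p (w j)"
    by (metis assms at_point_mult)
  then show "at_point p f = at_point p g"
    using weight_torus[of p j] p by simp
qed

text \<open>Applied to \<open>var j\<close>, a field returns its coefficient times a weight, which
  cancels. Identities of fields can thus be treated as identities of coefficient vectors.\<close>

lemma vector_field_inject: "vector_field F = vector_field G \<longleftrightarrow> F = G"
proof
  assume "vector_field F = vector_field G"
  then have "F j * w j = G j * w j" for j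
    using vector_field_var[of F j] vector_field_var[of G j] by simp
  then have "F j = G j" for j
    by (rule weight_cancel)
  then show "F = G"
    by blast
qed simp

lemma vector_field_add: "vector_field (F + G) = vector_field F + vector_field G"
  by (simp add: vector_field_def fun_eq_iff distrib_right sum.distrib)

lemma vector_field_pscale: "vector_field (\<lambda>i. pscale c (F i)) = op_scale c (vector_field F)"
  by (simp add: vector_field_def op_scale_def pscale_def fun_eq_iff sum_distrib_left mult.assoc)

text \<open>The second-order parts of the two compositions agree by \<open>frame_commute\<close>, so
  only derivatives of coefficients survive.\<close>

lemma commutator_vector_field:
  "commutator (vector_field F) (vector_field G) = vector_field (br F G)"
proof
  fix f
  have *: "vector_field F (vector_field G f) =
      (\<Sum>i\<in>UNIV. \<Sum>j\<in>UNIV. F i * \<delta> i (G j) * \<delta> j f) +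
      (\<Sum>i\<in>UNIV. \<Sum>j\<in>UNIV. F i * G j * \<delta> i (\<delta> j f))" for F G
    by (simp add: vector_field_def frame_sum frame_mult sum_distrib_left distrib_left sum.distrib mult.assoc)
  have "(\<Sum>i\<in>UNIV. \<Sum>j\<in>UNIV. F i * G j * \<delta> i (\<delta> j f)) =
      (\<Sum>i\<in>UNIV. \<Sum>j\<in>UNIV. G i * F j * \<delta> i (\<delta> j f))"
    by (subst sum.swap) (simp add: frame_commute mult_ac)
  then have "commutator (vector_field F) (vector_field G) f =
      (\<Sum>i\<in>UNIV. \<Sum>j\<in>UNIV. F i * \<delta> i (G j) * \<delta> j f) - (\<Sum>i\<in>UNIV. \<Sum>j\<in>UNIV. G i * \<delta> i (F j) * \<delta> j f)"
    unfolding commutator_def * by simp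
  also have "\<dots> = (\<Sum>j\<in>UNIV. \<Sum>i\<in>UNIV. F i * \<delta> i (G j) * \<delta> j f) - (\<Sum>j\<in>UNIV. \<Sum>i\<in>UNIV. G i * \<delta> i (F j) * \<delta> j f)"
    by (intro arg_cong2[of _ _ _ _ "(-)"] sum.swap)
  also have "\<dots> = vector_field (br F G) f"
    by (simp add: vector_field_def br_def sum_distrib_right left_diff_distrib sum_subtractf)
  finally show "commutator (vector_field F) (vector_field G) f = vector_field (br F G) f" .
qed

lemma br_lin: "lin (br Y)"
  unfolding lin_def
proof (intro conjI allI)
  show "br Y (F + G) = br Y F + br Y G" for F G
    by (simp add: br_def fun_eq_iff frame_add algebra_simps sum.distrib sum_subtractf)
  show "br Y (\<lambda>i. pscale c (F i)) = (\<lambda>i. pscale c (br Y F i))" for c F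
    unfolding br_def frame_pscale
    by (simp add: pscale_def fun_eq_iff sum_distrib_left right_diff_distrib mult_ac)
qed

text \<open>Local coordinates at a torus point \<open>p\<close>: they vanish there and their frame
  derivatives at \<open>p\<close> form the identity matrix.\<close>

definition chart :: "('n \<Rightarrow> complex) \<Rightarrow> 'n \<Rightarrow> 'n cpoly" where
  "chart p i = pscale (inverse (at_point p (w i))) (var i - pscale (p i) 1)"

lemma at_point_chart: "at_point p (chart p i) = 0"
  by (simp add: chart_def at_point_pscale at_point_diff)

lemma at_point_frame_chart:
  assumes "\<And>j. p j \<noteq> 0"
  shows "at_point p (\<delta> i (chart p j)) = (if i = j then 1 else 0)"
  using weight_torus[of p j] assms
  by (simp add: chart_def frame_pscale frame_diff frame_one frame_var at_point_pscale)

section \<open>Locally inner maps as differential operators of first order\<close>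

lemma at_point_br:
  "at_point p (br Y F j) =
     (\<Sum>i\<in>UNIV. at_point p (Y i) * at_point p (\<delta> i (F j)) - at_point p (F i) * at_point p (\<delta> i (Y j)))"
  by (simp add: br_def at_point_sum at_point_diff at_point_mult)

text \<open>
  Subtracting the first-order Taylor polynomial of \<open>F\<close> leaves a field whose brackets all vanish at \<open>p\<close>.
\<close>

lemma at_point_locally_inner:
  assumes "lin T" and inner: "\<And>F. \<exists>Y. T F = br Y F" and p: "\<And>j. p j \<noteq> 0"
  shows "at_point p (T F k) =
    (\<Sum>j\<in>UNIV. at_point p (F j) * at_point p (T (along j 1) k) +
       (\<Sum>i\<in>UNIV. at_point p (\<delta> i (F j)) * at_point p (T (along j (chart p i)) k)))"
proof -
  define L where "L = (\<lambda>j. pscale (at_point p (F j)) 1 +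
    (\<Sum>i\<in>UNIV. pscale (at_point p (\<delta> i (F j))) (chart p i)))"
  have sum_if: "(\<Sum>i\<in>UNIV. c i * (if l = i then 1 else 0)) = c l" for c :: "'n \<Rightarrow> complex" and l
    by (simp add: if_distrib[of "\<lambda>x. _ * x"] cong: if_cong)
  have L0: "at_point p ((F - L) j) = 0" for j
    by (simp add: L_def at_point_diff at_point_add at_point_sum at_point_pscale at_point_chart)
  have L1: "at_point p (\<delta> i ((F - L) j)) = 0" for i j
    using p
    by (simp add: L_def frame_diff frame_add frame_sum frame_pscale frame_one at_point_diff
        at_point_add at_point_sum at_point_pscale at_point_frame_chart sum_if)
  obtain Y where "T (F - L) = br Y (F - L)"
    using inner by blast
  then have "at_point p (T (F - L) k) = 0"
    using L0 L1 by (simp add: at_point_br)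
  then have "at_point p (T F k) = at_point p (T L k)"
    by (simp add: lin_diff[OF assms(1)] at_point_diff)
  moreover have "L j = pscale (at_point p (F j)) 1 +
      (\<Sum>i\<in>UNIV. pscale (at_point p (\<delta> i (F j))) (chart p i))" for j
    by (simp add: L_def)
  ultimately show ?thesis
    by (simp add: lin_decompose[OF assms(1), of L] lin_along_add[OF assms(1)]
        lin_along_sum[OF assms(1)] lin_along_pscale[OF assms(1)] at_point_add at_point_sum
        at_point_pscale)
qed

text \<open>
  At a zero of \<open>F\<close> the value of \<open>[Y, F]\<close> lies in the image of the linear part of \<open>F\<close>; the linear parts
  of rank one force the first-order coefficients of \<open>T\<close> to be those of a bracket.
\<close>

lemma at_point_along_chart:
  assumes "lin T" and inner: "\<And>F. \<exists>Y. T F = br Y F" and p: "\<And>j. p j \<noteq> 0"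
  shows "at_point p (T (along j (chart p i)) k) =
    (if j = k then at_point p (T (along i (chart p i)) i) else 0)"
proof -
  have sum_if: "(\<Sum>i\<in>UNIV. c i * (if i = l then 1 else 0)) = c l" for c :: "'n \<Rightarrow> complex" and l
    by (simp add: if_distrib[of "\<lambda>x. _ * x"] cong: if_cong)
  \<comment> \<open>The field vanishes at \<open>p\<close> and its component \<open>k\<close> is
    zero, so both terms of the bracket vanish there.\<close>
  have off: "at_point p (T (along j (chart p i)) k) = 0" if "j \<noteq> k" for j k
  proof -
    obtain Y where "T (along j (chart p i)) = br Y (along j (chart p i))"
      using inner by blast
    then show ?thesis
      using that by (simp add: at_point_br along_def at_point_chart frame_zero
          if_distrib[of "at_point p"] cong: if_cong)
  qed
  have diag: "at_point p (T (along j (chart p i)) j) = at_point p (T (along k (chart p i)) k)"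
    if "j \<noteq> k" for j k
  proof -
    \<comment> \<open>The linear part of this field at \<open>p\<close> has rank one, and its image
      is spanned by the sum of the basis vectors \<open>j\<close> and \<open>k\<close>; so
      components \<open>j\<close> and \<open>k\<close> of any bracket with it agree at
      \<open>p\<close>.\<close>
    define F where "F = along j (chart p i) + along k (chart p i)"
    obtain Y where Y: "T F = br Y F"
      using inner by blast
    have "at_point p (F l) = 0" for l
      by (simp add: F_def along_def at_point_add at_point_chart)
    moreover have "at_point p (\<delta> m (F l)) = (if m = i then 1 else 0)" if "l = j \<or> l = k" for l m
      using that \<open>j \<noteq> k\<close> p by (auto simp: F_def along_def at_point_frame_chart)
    ultimately have val: "at_point p (T F l) = at_point p (Y i)" if "l = j \<or> l = k" for l
      using that unfolding Y at_point_br by (simp add: sum_if)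
    have "at_point p (T F j) = at_point p (T (along j (chart p i)) j)"
      "at_point p (T F k) = at_point p (T (along k (chart p i)) k)"
      using off that by (simp_all add: F_def lin_add[OF assms(1)] at_point_add)
    then show ?thesis
      using val by metis
  qed
  show ?thesis
    using off diag by (cases "j = k"; cases "k = i") auto
qed

text \<open>The values at torus points found for \<open>along i (chart p i)\<close> have to come
  from a polynomial. Up to the factor \<open>w i\<close> they are the values of one polynomial, and
  the shape of the bracket makes it divisible by \<open>w i\<close>. Equality at all torus points
  then gives the operator identity.\<close>

lemma locally_inner_first_order:
  assumes "lin T" and inner: "\<And>F. \<exists>Y. T F = br Y F"
  obtains b where "\<And>F k. T F k =
    (\<Sum>j\<in>UNIV. F j * T (along j 1) k) + (\<Sum>i\<in>UNIV. b i * \<delta> i (F k))"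
proof -
  have "\<exists>b. T (along i (var i)) i - var i * T (along i 1) i = w i * b" for i
  proof -
    obtain Y where Y: "T (along i (var i)) = br Y (along i (var i))"
      using inner by blast
    \<comment> \<open>The first term carries \<open>w i\<close> from differentiating
      \<open>var i\<close>; the second carries \<open>var i\<close>, a multiple of
      \<open>w i\<close>.\<close>
    have "T (along i (var i)) i =
        (\<Sum>l\<in>UNIV. (if l = i then Y l * w i - var i * \<delta> i (Y i) else 0))"
      unfolding Y br_def by (rule sum.cong) (auto simp: along_def frame_var)
    then have "w i dvd T (along i (var i)) i"
      using weight_dvd[of i] by (simp add: dvd_diff)
    then have "w i dvd T (along i (var i)) i - var i * T (along i 1) i"
      using weight_dvd[of i] by (intro dvd_diff dvd_mult2)
    then show ?thesis
      by (auto elim: dvdE)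
  qed
  then obtain b where b: "\<And>i. T (along i (var i)) i - var i * T (along i 1) i = w i * b i"
    by metis
  have chart: "at_point p (T (along i (chart p i)) i) = at_point p (b i)" if "\<And>j. p j \<noteq> 0" for p i
  proof -
    have "T (along i (var i - pscale (p i) 1)) i = T (along i (var i)) i - pscale (p i) (T (along i 1) i)"
      using lin_along_add[OF assms(1), of i "var i - pscale (p i) 1" "pscale (p i) 1" i]
      by (simp add: lin_along_pscale[OF assms(1)])
    \<comment> \<open>At \<open>p\<close> the number \<open>p i\<close> is the value of
      \<open>var i\<close>; after this replacement the polynomial no longer depends on
      \<open>p\<close>.\<close>
    then have "at_point p (T (along i (chart p i)) i) = inverse (at_point p (w i)) *
        at_point p (T (along i (var i)) i - var i * T (along i 1) i)"
      by (simp add: chart_def lin_along_pscale[OF assms(1)] at_point_pscale at_point_diff at_point_mult)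
    then show ?thesis
      using weight_torus[of p i] that by (simp add: b at_point_mult)
  qed
  have "T F k = (\<Sum>j\<in>UNIV. F j * T (along j 1) k) + (\<Sum>i\<in>UNIV. b i * \<delta> i (F k))" for F k
  proof (rule eq_if_at_torus_eq)
    fix p :: "'n \<Rightarrow> complex"
    assume p: "\<And>j. p j \<noteq> 0"
    have jet: "at_point p (T (along j (chart p i)) k) = (if j = k then at_point p (b i) else 0)" for i j
      using at_point_along_chart[OF assms, of p j i k] chart[of p i] p by simp
    have "(\<Sum>j\<in>UNIV. \<Sum>i\<in>UNIV. at_point p (\<delta> i (F j)) * (if j = k then at_point p (b i) else 0)) =
        (\<Sum>j\<in>UNIV. if j = k then \<Sum>i\<in>UNIV. at_point p (\<delta> i (F k)) * at_point p (b i) else 0)"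
      by (rule sum.cong) auto
    then show "at_point p (T F k) =
        at_point p ((\<Sum>j\<in>UNIV. F j * T (along j 1) k) + (\<Sum>i\<in>UNIV. b i * \<delta> i (F k)))"
      by (simp add: at_point_locally_inner[OF assms, of p] p jet
          at_point_add at_point_sum at_point_mult sum.distrib mult_ac)
  qed
  then show thesis
    by (rule that)
qed

text \<open>
  Where \<open>F\<close> vanishes with invertible linear part \<open>J\<close>, an \<open>[Y, F]\<close> that also vanishes has a commutator
  with \<open>J\<close> as its linear part; so \<open>A J\<close> is traceless for enough matrices \<open>J\<close>.
\<close>

lemma locally_inner_zero_order:
  assumes inner: "\<And>F. \<exists>Y. (\<lambda>k. \<Sum>j\<in>UNIV. F j * A j k) = br Y F"
  shows "A a b = 0"
proof -
  \<comment> \<open>\<open>c = 0\<close> gives trace zero for \<open>A\<close> at \<open>p\<close>;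
    comparison with \<open>c = 1\<close> then isolates one entry.\<close>
  have key: "(\<Sum>k\<in>UNIV. at_point p (A k k)) + c * at_point p (A b a) = 0"
    if p: "\<And>j. p j \<noteq> 0" and c: "c = 0 \<or> c = 1" for p c a b
  proof -
    \<comment> \<open>The identity plus \<open>c\<close> times a matrix unit. It is invertible also
      for \<open>a = b\<close>, where the changed diagonal entry is \<open>1 + c\<close>.\<close>
    define J where "J l k = (if l = k then 1 else 0) + (if l = a \<and> k = b then c else 0)" for l k
    define F where "F = chart p + along b (pscale c (chart p a))"
    have F0: "at_point p (F j) = 0" for j
      by (simp add: F_def along_def at_point_add at_point_pscale at_point_chart)
    have F1: "at_point p (\<delta> l (F k)) = J l k" for l k
      using p by (simp add: F_def J_def along_def at_point_add frame_add frame_pscale frame_zero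
          at_point_pscale at_point_frame_chart)
    have sumJ: "(\<Sum>l\<in>UNIV. x l * J l k) = x k + (if k = b then c * x a else 0)" for x k
    proof -
      have "x l * J l k = (if l = k then x k else 0) + (if l = a then if k = b then c * x a else 0 else 0)" for l
        by (auto simp: J_def distrib_left)
      then show ?thesis
        by (simp add: sum.distrib)
    qed
    obtain Y where Y: "(\<lambda>k. \<Sum>j\<in>UNIV. F j * A j k) = br Y F"
      using inner by blast
    have "at_point p (br Y F k) = 0" for k
      unfolding Y[symmetric] by (simp add: at_point_sum at_point_mult F0)
    then have Y0: "at_point p (Y k) + (if k = b then c * at_point p (Y a) else 0) = 0" for k
      by (simp add: at_point_br F0 F1 sumJ)
    \<comment> \<open>\<open>Y0\<close> says that the row vector \<open>Y\<close> at
      \<open>p\<close> times \<open>J\<close> is zero, and \<open>J\<close> is invertible.\<close>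
    have Yz: "at_point p (Y k) = 0" for k
      using Y0[of k] Y0[of a] c by (cases "k = b"; cases "a = b") auto
    \<comment> \<open>Both \<open>F\<close> and \<open>Y\<close> vanish at \<open>p\<close>, so
      second derivatives drop out and the differentiated equation reads
      \<open>J A = Y' J - J Y'\<close> with \<open>Y'\<close> the Jacobian of \<open>Y\<close> at
      \<open>p\<close>.\<close>
    have "(\<Sum>j\<in>UNIV. J l j * at_point p (A j k)) =
        (\<Sum>i\<in>UNIV. at_point p (\<delta> l (Y i)) * J i k - J l i * at_point p (\<delta> i (Y k)))" for l k
    proof -
      have "\<delta> l (\<Sum>j\<in>UNIV. F j * A j k) = \<delta> l (br Y F k)"
        using Y by metis
      then have "at_point p (\<delta> l (\<Sum>j\<in>UNIV. F j * A j k)) = at_point p (\<delta> l (br Y F k))"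
        by simp
      then show ?thesis
        by (simp add: br_def frame_sum frame_mult frame_diff at_point_sum at_point_add at_point_diff
            at_point_mult F0 F1 Yz)
    qed
    then have "(\<Sum>k\<in>UNIV. \<Sum>j\<in>UNIV. J k j * at_point p (A j k)) =
        (\<Sum>k\<in>UNIV. \<Sum>i\<in>UNIV. at_point p (\<delta> k (Y i)) * J i k) -
        (\<Sum>k\<in>UNIV. \<Sum>i\<in>UNIV. J k i * at_point p (\<delta> i (Y k)))"
      by (simp add: sum_subtractf)
    \<comment> \<open>The trace of a commutator vanishes.\<close>
    also have "\<dots> = 0"
      by (subst sum.swap) (simp add: mult.commute)
    also have "(\<Sum>k\<in>UNIV. \<Sum>j\<in>UNIV. J k j * at_point p (A j k)) =
        (\<Sum>j\<in>UNIV. \<Sum>k\<in>UNIV. at_point p (A j k) * J k j)"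
      by (subst sum.swap) (simp add: mult.commute)
    also have "\<dots> = (\<Sum>k\<in>UNIV. at_point p (A k k)) + c * at_point p (A b a)"
      by (simp add: sumJ sum.distrib)
    finally show ?thesis .
  qed
  show ?thesis
    by (rule zero_if_at_torus_zero) (use key[of _ 0] key[of _ 1 a b] in simp)
qed

section \<open>From locally inner to inner maps\<close>

lemma br_add_left: "br (Y + Z) F = br Y F + br Z F"
  by (simp add: br_def fun_eq_iff frame_add algebra_simps sum.distrib sum_subtractf)

lemma br_diff_left: "br (Y - Z) F = br Y F - br Z F"
  using br_add_left[of "Y - Z" Z F] by (simp add: algebra_simps)

text \<open>Subtracting \<open>br b\<close>, with \<open>b\<close> from the first-order part, leaves
  multiplication by a matrix. The difference is still locally inner because \<open>br\<close> is
  additive on the left, so the matrix vanishes.\<close>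

theorem locally_inner_imp_inner:
  assumes "lin T" and inner: "\<And>F. \<exists>Y. T F = br Y F"
  obtains b where "\<And>F. T F = br b F"
proof -
  obtain b where b: "\<And>F k. T F k =
      (\<Sum>j\<in>UNIV. F j * T (along j 1) k) + (\<Sum>i\<in>UNIV. b i * \<delta> i (F k))"
    using locally_inner_first_order[OF assms] by blast
  define A where "A j k = T (along j 1) k + \<delta> j (b k)" for j k
  have TA: "T F - br b F = (\<lambda>k. \<Sum>j\<in>UNIV. F j * A j k)" for F
    by (rule ext) (simp add: b[of F] br_def A_def distrib_left sum.distrib sum_subtractf)
  have "\<exists>Y. (\<lambda>k. \<Sum>j\<in>UNIV. F j * A j k) = br Y F" for F
    using inner[of F] br_diff_left[of _ b F] TA[of F] by metis
  then have "A j k = 0" for j k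
    by (rule locally_inner_zero_order)
  then have "T F - br b F = 0" for F
    unfolding TA by (simp add: fun_eq_iff)
  then have "T F = br b F" for F
    by (metis right_minus_eq)
  then show thesis
    by (rule that)
qed

section \<open>Derivations in coefficient vectors\<close>

definition bracket_derivation :: "(('n \<Rightarrow> 'n cpoly) \<Rightarrow> 'n \<Rightarrow> 'n cpoly) \<Rightarrow> bool" where
  "bracket_derivation T \<longleftrightarrow> lin T \<and> (\<forall>F G. T (br F G) = br (T F) G + br F (T G))"

lemma commutator_derivation:
  assumes "D \<in> W_plus" "E \<in> W_plus" "E' \<in> W_plus"
  shows "commutator D (commutator E E') = commutator (commutator D E) E' + commutator E (commutator D E')"
  by (simp add: commutator_def fun_eq_iff W_plus_diff[OF assms(1)] W_plus_diff[OF assms(2)]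
      W_plus_diff[OF assms(3)])

text \<open>The Jacobi identity, carried over from operators by injectivity of
  \<open>vector_field\<close>.\<close>

lemma bracket_derivation_br: "bracket_derivation (br Y)"
  unfolding bracket_derivation_def
proof (intro conjI allI br_lin)
  show "br Y (br F G) = br (br Y F) G + br F (br Y G)" for F G
    using commutator_derivation[OF vector_field_in_W_plus vector_field_in_W_plus vector_field_in_W_plus]
    by (metis commutator_vector_field vector_field_add vector_field_inject)
qed

lemma lin_add_maps: "lin S \<Longrightarrow> lin T \<Longrightarrow> lin (\<lambda>F. S F + T F)"
  by (simp add: lin_def fun_eq_iff pscale_add)

lemma br_add_right: "br Y (F + G) = br Y F + br Y G"
  by (rule lin_add[OF br_lin])

lemma bracket_derivation_add:
  assumes "bracket_derivation S" "bracket_derivation T"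
  shows "bracket_derivation (\<lambda>F. S F + T F)"
  using assms by (auto simp: bracket_derivation_def lin_add_maps br_add_left br_add_right fun_eq_iff)

lemma br_along_one_left: "br (along i 1) F = (\<lambda>j. \<delta> i (F j))"
proof
  fix j
  have "along i 1 l * \<delta> l (F j) - F l * \<delta> l (along i 1 j) = (if l = i then \<delta> i (F j) else 0)" for l
    by (simp add: along_def frame_zero frame_one)
  then show "br (along i 1) F j = \<delta> i (F j)"
    by (simp add: br_def)
qed

lemma br_anticommute: "br F G = - br G F"
  by (simp add: br_def fun_eq_iff flip: sum_negf)

lemma br_along_one_right: "br F (along i 1) = (\<lambda>j. - \<delta> i (F j))"
  by (subst br_anticommute) (simp add: br_along_one_left fun_eq_iff)

text \<open>Constant fields commute, so the derivation rule for their bracket yields this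
  integrability condition for a potential.\<close>

lemma bracket_derivation_frame_commute:
  assumes "bracket_derivation T"
  shows "\<delta> i (T (along j 1) k) = \<delta> j (T (along i 1) k)"
proof -
  have "br (along i 1) (along j 1) = 0"
    unfolding br_along_one_left by (simp add: along_def fun_eq_iff frame_zero frame_one)
  then have "br (T (along i 1)) (along j 1) + br (along i 1) (T (along j 1)) = T 0"
    using assms by (metis bracket_derivation_def)
  also have "T 0 = 0"
    using assms lin_zero unfolding bracket_derivation_def by blast
  finally show ?thesis
    by (simp add: br_along_one_left br_along_one_right fun_eq_iff)
qed

text \<open>In coordinates \<open>inner\<close> makes \<open>\<Delta>\<close> locally inner, hence a
  bracket with one fixed field, and the Jacobi identity makes that a derivation.\<close>

theorem local_derivation_imp_derivation:
  assumes L: "L = range vector_field" and "lie_algebra op_scale L commutator"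
    and inner: "\<And>T. bracket_derivation T \<Longrightarrow> \<exists>Y. \<forall>F. T F = br Y F"
    and local: "lie_algebra.local_derivation op_scale L commutator \<Delta>"
  shows "lie_algebra.derivation op_scale L commutator \<Delta>"
proof -
  interpret lie_algebra op_scale L commutator by fact
  \<comment> \<open>The coefficient vector of the image of the field \<open>F\<close>; it is unique
    by injectivity, and exists when \<open>D\<close> preserves \<open>L\<close>.\<close>
  define coord where "coord D F = inv vector_field (D (vector_field F))" for D F
  have coord: "vector_field (coord D F) = D (vector_field F)" if "linear_endo D" for D F
  proof -
    have "D (vector_field F) \<in> range vector_field"
      using that unfolding linear_endo_def unfolding L by blast
    then show ?thesis
      unfolding coord_def by (rule f_inv_into_f)
  qed
  have lin_coord: "lin (coord D)" if "linear_endo D" for D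
    unfolding lin_def vector_field_inject[symmetric] vector_field_add vector_field_pscale
      coord[OF that]
    using that unfolding linear_endo_def unfolding L by blast
  have derivation_inner: "\<exists>Y. \<forall>F. D (vector_field F) = vector_field (br Y F)" if "derivation D" for D
  proof -
    have D: "linear_endo D"
      using that by (simp add: derivation_def)
    have "coord D (br F G) = br (coord D F) G + br F (coord D G)" for F G
      unfolding vector_field_inject[symmetric] vector_field_add commutator_vector_field[symmetric]
        coord[OF D]
      using that unfolding derivation_def unfolding L by blast
    then have "bracket_derivation (coord D)"
      by (simp add: bracket_derivation_def lin_coord[OF D])
    then show ?thesis
      using inner coord[OF D] by metis
  qed
  have lin: "linear_endo \<Delta>"
    using local by (simp add: local_derivation_def)
  have "\<exists>Y. coord \<Delta> F = br Y F" for F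
  proof -
    obtain D where "derivation D" "\<Delta> (vector_field F) = D (vector_field F)"
      using local unfolding local_derivation_def unfolding L by blast
    then show ?thesis
      using derivation_inner coord[OF lin] by (metis vector_field_inject)
  qed
  then obtain b where "\<And>F. coord \<Delta> F = br b F"
    using locally_inner_imp_inner[OF lin_coord[OF lin]] by blast
  then have "\<Delta> X = commutator (vector_field b) X" if "X \<in> L" for X
    using that coord[OF lin] unfolding L by (metis commutator_vector_field imageE)
  moreover have "X \<in> W_plus" if "X \<in> L" for X
    using that vector_field_in_W_plus unfolding L by blast
  ultimately show ?thesis
    unfolding derivation_def
    using lin bracket_closed commutator_derivation[OF vector_field_in_W_plus] by simp
qed

end

section \<open>The two frames\<close>

lemma partial_commute: "partial i (partial j f) = partial j (partial i f)"
proof (induction f rule: cpoly_induct)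
  case (single \<alpha> c)
  show ?case
  proof (cases "i = j")
    case False
    have "\<alpha> - unit_exp j - unit_exp i = \<alpha> - unit_exp i - unit_exp j"
      by (simp add: diff_diff_add add.commute)
    then show ?thesis
      using False by (simp add: partial_single lookup_minus unit_exp_def lookup_single mult_ac)
  qed simp
qed (simp_all add: partial_zero partial_add)

lemma partial_var: "partial i (var j) = (if i = j then 1 else 0)"
  by (auto simp: var_def monomial_def partial_single unit_exp_def lookup_single)

lemma euler_var: "euler i (var j) = (if i = j then var i else 0)"
  by (simp add: euler_def poly_act_def partial_var)

interpretation partial: commuting_frame partial "\<lambda>_. 1"
  by unfold_locales (auto simp: partial_in_W_plus partial_var intro: partial_commute)

interpretation euler: commuting_frame euler var
  by unfold_locales (auto simp: euler_in_W_plus euler_var intro: euler_commute)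

section \<open>Multi-exponents, and both algebras as sets of vector fields\<close>

lemma exponent_nonzeroE:
  fixes \<alpha> :: "'n::finite \<Rightarrow>\<^sub>0 nat"
  assumes "\<alpha> \<noteq> 0"
  obtains i where "Poly_Mapping.lookup \<alpha> i \<noteq> 0"
  using assms by (metis lookup_zero poly_mapping_eqI)

lemma degree_diff_unit_less:
  fixes \<alpha> :: "'n::finite \<Rightarrow>\<^sub>0 nat"
  assumes "Poly_Mapping.lookup \<alpha> i \<noteq> 0"
  shows "(\<Sum>k\<in>UNIV. Poly_Mapping.lookup (\<alpha> - unit_exp i) k) < (\<Sum>k\<in>UNIV. Poly_Mapping.lookup \<alpha> k)"
proof (rule sum_strict_mono_ex1)
  show "\<forall>k\<in>UNIV. Poly_Mapping.lookup (\<alpha> - unit_exp i) k \<le> Poly_Mapping.lookup \<alpha> k"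
    by (simp add: lookup_minus)
  show "\<exists>k\<in>UNIV. Poly_Mapping.lookup (\<alpha> - unit_exp i) k < Poly_Mapping.lookup \<alpha> k"
    using assms by (intro bexI[of _ i]) (auto simp: lookup_minus unit_exp_def)
qed simp

lemma exponent_induct [case_names zero unit]:
  fixes \<alpha> :: "'n::finite \<Rightarrow>\<^sub>0 nat"
  assumes "P 0" "\<And>i \<alpha>. P \<alpha> \<Longrightarrow> P (unit_exp i + \<alpha>)"
  shows "P \<alpha>"
proof (induction "\<Sum>i\<in>UNIV. Poly_Mapping.lookup \<alpha> i" arbitrary: \<alpha> rule: less_induct)
  case less
  show ?case
  proof (cases "\<alpha> = 0")
    case False
    then obtain i where i: "Poly_Mapping.lookup \<alpha> i \<noteq> 0"
      by (rule exponent_nonzeroE)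
    have eq: "unit_exp i + (\<alpha> - unit_exp i) = \<alpha>"
      by (rule poly_mapping_eqI)
        (use i in \<open>auto simp: lookup_add lookup_minus unit_exp_def lookup_single when_def\<close>)
    show ?thesis
      using assms(2)[of "\<alpha> - unit_exp i" i] less degree_diff_unit_less[OF i] by (simp add: eq)
  qed (use assms(1) in simp)
qed

lemma monomial_zero [simp]: "monomial 0 = 1"
  by (simp add: monomial_def)

lemma monomial_add: "monomial (\<alpha> + \<beta>) = monomial \<alpha> * monomial \<beta>"
  by (simp add: monomial_def mult_single)

lemma single_eq_pscale: "Poly_Mapping.single \<alpha> c = pscale c (monomial \<alpha>)"
  by (simp add: pscale_def monomial_def mult_single)

text \<open>The Leibniz rule carries agreement from the variables to monomials, and linearity
  carries it to all polynomials.\<close>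

lemma W_plus_eqI:
  assumes "D \<in> W_plus" "E \<in> W_plus" "\<And>i. D (var i) = E (var i)"
  shows "D = E"
proof
  fix f
  have "D (monomial \<alpha>) = E (monomial \<alpha>)" for \<alpha>
  proof (induction \<alpha> rule: exponent_induct)
    case (unit i \<alpha>)
    have "monomial (unit_exp i + \<alpha>) = var i * monomial \<alpha>"
      by (simp add: monomial_add var_def)
    then show ?case
      using unit by (simp add: W_plus_mult[OF assms(1)] W_plus_mult[OF assms(2)] assms(3))
  qed (simp add: W_plus_one assms)
  then show "D f = E f"
    by (induction f rule: cpoly_induct)
      (simp_all add: W_plus_zero W_plus_add single_eq_pscale W_plus_scale assms(1,2))
qed

text \<open>The coefficients of a derivation are its values on the variables.\<close>

lemma W_plus_eq_range: "W_plus = range partial.vector_field"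
proof -
  have "D = partial.vector_field (\<lambda>i. D (var i))" if "D \<in> W_plus" for D :: "'a poly_op"
    by (rule W_plus_eqI) (simp_all add: that partial.vector_field_in_W_plus partial.vector_field_var)
  then show ?thesis
    using partial.vector_field_in_W_plus by blast
qed

lemma W_plus_plus_eq_range: "W_plus_plus = range euler.vector_field"
proof
  have "euler.vector_field F = (\<Sum>i\<in>UNIV. poly_act (F i) (euler i))" for F :: "'a \<Rightarrow> 'a cpoly"
    by (rule ext) (simp add: euler.vector_field_def sum_fun_apply poly_act_def)
  then show "range euler.vector_field \<subseteq> (W_plus_plus :: 'a poly_op set)"
    by (auto intro!: op.subspace_sum subspace_W_plus_plus poly_act_euler_in)
  have "op.subspace (range euler.vector_field :: 'a poly_op set)"
  proof (rule op.subspaceI)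
    have "euler.vector_field 0 = (0 :: 'a poly_op)"
      by (simp add: euler.vector_field_def fun_eq_iff)
    then show "0 \<in> range (euler.vector_field :: _ \<Rightarrow> 'a poly_op)"
      by (metis rangeI)
  qed (auto simp flip: euler.vector_field_add euler.vector_field_pscale)
  moreover have "poly_act f (euler i) = euler.vector_field (along i f)" for f and i :: 'a
  proof
    fix g
    have "along i f l * euler l g = (if l = i then f * euler i g else 0)" for l
      by (simp add: along_def)
    then show "poly_act f (euler i) g = euler.vector_field (along i f) g"
      by (simp add: euler.vector_field_def poly_act_def)
  qed
  ultimately show "(W_plus_plus :: 'a poly_op set) \<subseteq> range euler.vector_field"
    unfolding W_plus_plus_span by (intro op.span_minimal) auto
qed

section \<open>Derivations are inner\<close>

lemma lookup_pscale: "Poly_Mapping.lookup (pscale c f) \<alpha> = c * Poly_Mapping.lookup f \<alpha>"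
proof (induction f rule: cpoly_induct)
  case (single \<beta> a)
  show ?case
    by (simp add: pscale_def mult_single lookup_single when_def)
qed (simp_all add: pscale_add lookup_add distrib_left)

lemma lookup_euler:
  "Poly_Mapping.lookup (euler i f) \<alpha> = of_nat (Poly_Mapping.lookup \<alpha> i) * Poly_Mapping.lookup f \<alpha>"
  by (induction f rule: cpoly_induct)
    (auto simp: euler.frame_zero euler.frame_add euler_single lookup_add lookup_single when_def
      distrib_left)

lemma lookup_monomial: "Poly_Mapping.lookup (monomial \<alpha>) \<beta> = (if \<alpha> = \<beta> then 1 else 0)"
  by (simp add: monomial_def lookup_single when_def)

lemma lookup_sum_single:
  "finite A \<Longrightarrow> Poly_Mapping.lookup (\<Sum>\<alpha>\<in>A. Poly_Mapping.single \<alpha> (c \<alpha>)) \<beta> = (if \<beta> \<in> A then c \<beta> else 0)"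
  by (simp add: lookup_sum lookup_single when_def)

text \<open>\<open>euler i\<close> multiplies the coefficient at \<alpha> by the \<open>i\<close>-th
  entry of \<alpha>. For \<alpha> \<noteq> 0 divide by any nonzero entry; the assumption makes the
  choice immaterial. The coefficient at 0 is never reached, so it is removed from
  \<open>g i\<close>.\<close>

lemma euler_potential:
  fixes g :: "'n::finite \<Rightarrow> 'n cpoly"
  assumes "\<And>i j. euler i (g j) = euler j (g i)"
  obtains f where "\<And>i. euler i f = g i - pscale (Poly_Mapping.lookup (g i) 0) 1"
proof -
  have "\<exists>s. \<forall>\<alpha>::'n \<Rightarrow>\<^sub>0 nat. \<alpha> \<noteq> 0 \<longrightarrow> Poly_Mapping.lookup \<alpha> (s \<alpha>) \<noteq> 0"
    by (intro choice allI) (metis exponent_nonzeroE)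
  then obtain s where s: "\<And>\<alpha>::'n \<Rightarrow>\<^sub>0 nat. \<alpha> \<noteq> 0 \<Longrightarrow> Poly_Mapping.lookup \<alpha> (s \<alpha>) \<noteq> 0"
    by blast
  define A where "A = (\<Union>i. Poly_Mapping.keys (g i)) - {0}"
  define f where "f = (\<Sum>\<alpha>\<in>A. Poly_Mapping.single \<alpha>
    (Poly_Mapping.lookup (g (s \<alpha>)) \<alpha> / of_nat (Poly_Mapping.lookup \<alpha> (s \<alpha>))))"
  have sym: "of_nat (Poly_Mapping.lookup \<alpha> i) * Poly_Mapping.lookup (g j) \<alpha> =
      of_nat (Poly_Mapping.lookup \<alpha> j) * Poly_Mapping.lookup (g i) \<alpha>" for \<alpha> i j
    using assms[of i j] by (metis lookup_euler)
  have "euler i f = g i - pscale (Poly_Mapping.lookup (g i) 0) 1" for i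
  proof (rule poly_mapping_eqI)
    fix \<alpha>
    have fin: "finite A"
      by (simp add: A_def)
    have "Poly_Mapping.lookup (euler i f) \<alpha> = (if \<alpha> = 0 then 0 else Poly_Mapping.lookup (g i) \<alpha>)"
    proof (cases "\<alpha> \<in> A")
      case True
      then have "\<alpha> \<noteq> 0"
        by (simp add: A_def)
      then show ?thesis
        using True s[of \<alpha>] sym[of \<alpha> i "s \<alpha>"]
        by (simp add: f_def lookup_euler lookup_sum_single[OF fin] divide_eq_eq mult.commute)
    next
      case False
      then have "\<alpha> = 0 \<or> Poly_Mapping.lookup (g i) \<alpha> = 0"
        by (auto simp: A_def in_keys_iff)
      then show ?thesis
        using False by (auto simp: f_def lookup_euler lookup_sum_single[OF fin])
    qed
    then show "Poly_Mapping.lookup (euler i f) \<alpha> =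
        Poly_Mapping.lookup (g i - pscale (Poly_Mapping.lookup (g i) 0) 1) \<alpha>"
      using lookup_monomial[of 0 \<alpha>] by (auto simp: lookup_minus lookup_pscale)
  qed
  then show thesis
    by (rule that)
qed

lemma euler_eq: "euler i f = var i * partial i f"
  by (simp add: euler_def poly_act_def)

lemma lookup_var_mult_zero: "Poly_Mapping.lookup (var i * f) 0 = 0"
proof (induction f rule: cpoly_induct)
  case (single \<beta> c)
  have "Poly_Mapping.lookup (unit_exp i + \<beta>) i \<noteq> 0"
    by (simp add: lookup_add unit_exp_def)
  then have "unit_exp i + \<beta> \<noteq> 0"
    by (metis lookup_zero)
  then show ?case
    by (simp add: var_def monomial_def mult_single lookup_single)
qed (simp_all add: distrib_left lookup_add)

lemma partial_monomial:
  "partial i (monomial \<alpha>) = pscale (of_nat (Poly_Mapping.lookup \<alpha> i)) (monomial (\<alpha> - unit_exp i))"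
  by (simp add: monomial_def partial_single flip: single_eq_pscale[unfolded monomial_def])

text \<open>The polynomial Poincare lemma. Multiplying by variables reduces it to Euler operators,
  and \<open>var i * g i\<close> has no constant term to correct for.\<close>

lemma partial_potential:
  fixes g :: "'n::finite \<Rightarrow> 'n cpoly"
  assumes "\<And>i j. partial i (g j) = partial j (g i)"
  obtains f where "\<And>i. partial i f = g i"
proof -
  have "euler i (var j * g j) = euler j (var i * g i)" for i j
    using assms[of i j] by (simp add: euler_eq partial_mult partial_var algebra_simps)
  then obtain f where f: "\<And>i. euler i f =
      var i * g i - pscale (Poly_Mapping.lookup (var i * g i) 0) 1"
    using euler_potential[of "\<lambda>i. var i * g i"] by blast
  have "Poly_Mapping.lookup (var i * g i) 0 = 0" for i
    by (rule lookup_var_mult_zero)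
  then have "partial i f * var i = g i * var i" for i
    using f[of i] by (simp add: euler_eq mult.commute pscale_def)
  then show thesis
    using that euler.weight_cancel by metis
qed

section \<open>Derivations in the frame of partial derivatives\<close>

lemma lin_eqI:
  assumes "lin S" "lin T" "\<And>j \<alpha>. S (along j (monomial \<alpha>)) = T (along j (monomial \<alpha>))"
  shows "S F = T F"
proof -
  have "S (along j f) k = T (along j f) k" for j f k
    by (induction f rule: cpoly_induct)
      (simp_all add: lin_along_zero lin_along_add lin_along_pscale single_eq_pscale assms)
  then show ?thesis
    by (intro ext) (simp add: lin_decompose[OF assms(1), of F] lin_decompose[OF assms(2), of F])
qed

text \<open>
  The translations \<open>\<partial>\<^sub>i\<close> are killed after subtracting an inner derivation, by integrating a closed
  form; a constant field then also kills the Euler field \<open>var\<close>, whose eigenvalues separate constant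
  fields from the others.
\<close>

theorem partial_derivation_inner:
  fixes T :: "('n::finite \<Rightarrow> 'n cpoly) \<Rightarrow> 'n \<Rightarrow> 'n cpoly"
  assumes "partial.bracket_derivation T"
  shows "\<exists>Y. \<forall>F. T F = partial.br Y F"
proof -
  have "\<exists>f. \<forall>i. partial i f = T (along i 1) j" for j
    using partial_potential[of "\<lambda>i. T (along i 1) j"]
      partial.bracket_derivation_frame_commute[OF assms] by metis
  then obtain f where f: "\<And>i j. partial i (f j) = T (along i 1) j"
    by metis
  define S where "S = (\<lambda>F. T F + partial.br f F)"
  have S: "partial.bracket_derivation S"
    unfolding S_def by (intro partial.bracket_derivation_add assms partial.bracket_derivation_br)
  have S_along: "S (along i 1) = 0" for i
    by (simp add: S_def partial.br_along_one_right f fun_eq_iff)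
  have br0: "partial.br 0 F = 0" for F :: "'n \<Rightarrow> 'n cpoly"
    by (simp add: partial.br_def fun_eq_iff partial_zero)
  \<comment> \<open>Bracketing with \<open>along i 1\<close> differentiates all components, so a
    derivation that kills these fields commutes with \<open>partial i\<close>.\<close>
  have comm: "partial i (R F k) = R (\<lambda>j. partial i (F j)) k"
    if "partial.bracket_derivation R" "\<And>i. R (along i 1) = 0" for R F and i k :: 'n
  proof -
    have "R (partial.br (along i 1) F) = partial.br (R (along i 1)) F + partial.br (along i 1) (R F)"
      using that unfolding partial.bracket_derivation_def by blast
    then show ?thesis
      by (simp add: that br0 partial.br_along_one_left)
  qed
  define C where "C = S var"
  have "(\<lambda>j. partial i (var j)) = along i 1" for i :: 'n
    by (auto simp: partial_var along_def)
  \<comment> \<open>The derivatives of \<open>var\<close> are fields that \<open>S\<close> kills, so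
    \<open>C\<close> has constant components.\<close>
  then have C0: "partial i (C k) = 0" for i k
    unfolding C_def comm[OF S S_along] by (simp add: S_along)
  define R where "R = (\<lambda>F. S F + partial.br (- C) F)"
  have R: "partial.bracket_derivation R"
    unfolding R_def by (intro partial.bracket_derivation_add S partial.bracket_derivation_br)
  have C0': "partial i (- C k) = 0" for i k
    using partial.frame_diff[of i 0 "C k"] by (simp add: C0 partial_zero)
  have R_along: "R (along i 1) = 0" for i
    by (simp add: R_def partial.br_along_one_right S_along fun_eq_iff C0')
  \<comment> \<open>Constant fields are reproduced by the bracket with \<open>var\<close>; hence
    adding the bracket with \<open>- C\<close> cancels \<open>S var\<close>.\<close>
  have br_var: "partial.br V var = V" if "\<And>i k. partial i (V k) = 0" for V :: "'n \<Rightarrow> 'n cpoly"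
    by (simp add: partial.br_def that partial_var fun_eq_iff if_distrib[of "\<lambda>x. _ * x"] cong: if_cong)
  have R_var: "R var = 0"
    using br_var[of "- C"] C0' by (simp add: R_def C_def)
  have R_zero: "R (along j (monomial \<alpha>)) = 0" for j \<alpha>
  proof (induction "\<Sum>i\<in>UNIV. Poly_Mapping.lookup \<alpha> i" arbitrary: \<alpha> rule: less_induct)
    case less
    let ?X = "along j (monomial \<alpha>)"
    let ?d = "\<Sum>i\<in>UNIV. Poly_Mapping.lookup \<alpha> i"
    have linR: "lin R"
      using R by (simp add: partial.bracket_derivation_def)
    show ?case
    proof (cases "\<alpha> = 0")
      case False
      then obtain m where m: "Poly_Mapping.lookup \<alpha> m \<noteq> 0"
        by (rule exponent_nonzeroE)
      have d: "?d \<noteq> 0"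
        using m by auto
      \<comment> \<open>Derivatives of \<open>?X\<close> are zero or multiples of monomial fields of
        smaller degree, so by induction all derivatives of its image vanish.\<close>
      have const: "partial i (R ?X k) = 0" for i k
      proof (cases "Poly_Mapping.lookup \<alpha> i = 0")
        case True
        then have "(\<lambda>l. partial i (?X l)) = 0"
          by (auto simp: along_def monomial_def partial_single partial_zero)
        then show ?thesis
          unfolding comm[OF R R_along] by (simp add: lin_zero[OF linR])
      next
        case False
        then have "(\<Sum>k\<in>UNIV. Poly_Mapping.lookup (\<alpha> - unit_exp i) k) < ?d"
          by (rule degree_diff_unit_less)
        then have "R (along j (monomial (\<alpha> - unit_exp i))) = 0"
          using less by blast
        moreover have "(\<lambda>l. partial i (?X l)) =
            along j (pscale (of_nat (Poly_Mapping.lookup \<alpha> i)) (monomial (\<alpha> - unit_exp i)))"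
          by (auto simp: along_def partial_monomial partial_zero)
        ultimately show ?thesis
          unfolding comm[OF R R_along] by (simp add: lin_along_pscale[OF linR])
      qed
      \<comment> \<open>The field \<open>var\<close> acts on \<open>?X\<close> with eigenvalue
        \<open>?d - 1\<close> and on the constant field \<open>R ?X\<close> with eigenvalue -1;
        these differ since \<open>?d\<close> is nonzero.\<close>
      have "partial.br var ?X = along j (pscale (of_nat ?d - 1) (monomial \<alpha>))"
      proof
        fix k
        have "(\<Sum>i\<in>UNIV. euler i (monomial \<alpha>)) = pscale (of_nat ?d) (monomial \<alpha>)"
          by (rule poly_mapping_eqI)
            (auto simp: lookup_sum lookup_euler lookup_pscale lookup_monomial simp flip: sum_distrib_right)
        moreover have "along j (monomial \<alpha>) i * partial i (var k) = (if i = k then along j (monomial \<alpha>) k else 0)" for i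
          by (simp add: partial_var)
        ultimately show "partial.br var ?X k = along j (pscale (of_nat ?d - 1) (monomial \<alpha>)) k"
          by (auto simp: partial.br_def sum_subtractf along_def partial_zero euler.frame_zero pscale_def
              left_diff_distrib single_diff simp flip: euler_eq)
      qed
      then have "R (along j (pscale (of_nat ?d - 1) (monomial \<alpha>))) =
          partial.br (R var) ?X + partial.br var (R ?X)"
        using R unfolding partial.bracket_derivation_def by metis
      also have "\<dots> = - R ?X"
        using br_var[OF const] partial.br_anticommute[of var "R ?X"] by (simp add: R_var br0)
      finally have "pscale (of_nat ?d - 1) (R ?X k) = - R ?X k" for k
        by (metis fun_Compl_def lin_along_pscale[OF linR])
      then have "(of_nat ?d - 1) * Poly_Mapping.lookup (R ?X k) \<beta> = - Poly_Mapping.lookup (R ?X k) \<beta>" for k \<beta>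
        by (metis lookup_pscale lookup_uminus)
      then have "of_nat ?d * Poly_Mapping.lookup (R ?X k) \<beta> = 0" for k \<beta>
        by (simp add: left_diff_distrib)
      then have "Poly_Mapping.lookup (R ?X k) \<beta> = 0" for k \<beta>
        using d by (metis mult_eq_0_iff of_nat_eq_0_iff)
      then show ?thesis
        by (intro ext poly_mapping_eqI) simp
    qed (use R_along in simp)
  qed
  have "R F = 0" for F
    using lin_eqI[of R "\<lambda>_. 0" F] R R_zero
    by (simp add: partial.bracket_derivation_def lin_def fun_eq_iff)
  then have "T F + (partial.br f F + partial.br (- C) F) = 0" for F
    unfolding R_def S_def add.assoc .
  then have "T F = 0 - partial.br (f + - C) F" for F
    unfolding partial.br_add_left diff_0 by (rule eq_neg_iff_add_eq_0[THEN iffD2])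
  then have "T F = partial.br (0 - (f + - C)) F" for F
    unfolding partial.br_diff_left br0 .
  then show ?thesis
    by blast
qed

section \<open>Monomial fields and derivations in the Euler frame\<close>

definition monomial_field :: "('n::finite \<Rightarrow>\<^sub>0 nat) \<Rightarrow> ('n \<Rightarrow> complex) \<Rightarrow> 'n \<Rightarrow> 'n cpoly" where
  "monomial_field \<beta> h = (\<lambda>k. pscale (h k) (monomial \<beta>))"

text \<open>The eigenvalue on the monomial \<beta> of the Cartan element with coordinates
  \<open>h\<close>; \<open>monomial_field \<beta> h\<close> is that monomial times this
  element.\<close>

definition pairing :: "('n::finite \<Rightarrow>\<^sub>0 nat) \<Rightarrow> ('n \<Rightarrow> complex) \<Rightarrow> complex" where
  "pairing \<beta> h = (\<Sum>i\<in>UNIV. of_nat (Poly_Mapping.lookup \<beta> i) * h i)"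

lemma pairing_add: "pairing (\<beta> + \<gamma>) h = pairing \<beta> h + pairing \<gamma> h"
  by (simp add: pairing_def lookup_add distrib_right sum.distrib)

lemma pairing_unit_exp: "pairing (unit_exp i) h = h i"
proof -
  have "of_nat (Poly_Mapping.lookup (unit_exp i) l) * h l = (if l = i then h i else 0)" for l
    by (auto simp: unit_exp_def lookup_single)
  then show ?thesis
    by (simp add: pairing_def)
qed

lemma pscale_pscale: "pscale a (pscale b f) = pscale (a * b) f"
  by (rule poly_mapping_eqI) (simp add: lookup_pscale)

lemma pscale_add_left: "pscale (a + b) f = pscale a f + pscale b f"
  by (rule poly_mapping_eqI) (simp add: lookup_pscale lookup_add distrib_right)

lemma pscale_diff_left: "pscale (a - b) f = pscale a f - pscale b f"
  by (rule poly_mapping_eqI) (simp add: lookup_pscale lookup_minus left_diff_distrib)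

lemma pscale_sum_left: "pscale (sum c A) f = (\<Sum>i\<in>A. pscale (c i) f)"
  by (rule poly_mapping_eqI) (simp add: lookup_pscale lookup_sum sum_distrib_right)

lemma pscale_mult: "pscale a f * pscale b g = pscale (a * b) (f * g)"
proof -
  have "pscale a f * pscale b g = (Poly_Mapping.single 0 a * Poly_Mapping.single 0 b) * (f * g)"
    by (simp add: pscale_def mult_ac)
  then show ?thesis
    by (simp add: mult_single pscale_def)
qed

lemma euler_monomial: "euler i (monomial \<alpha>) = pscale (of_nat (Poly_Mapping.lookup \<alpha> i)) (monomial \<alpha>)"
  by (rule poly_mapping_eqI) (simp add: lookup_euler lookup_pscale lookup_monomial)

lemma monomial_field_inject: "monomial_field \<beta> h = monomial_field \<beta> h' \<longleftrightarrow> h = h'"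
proof
  assume "monomial_field \<beta> h = monomial_field \<beta> h'"
  then have "Poly_Mapping.lookup (monomial_field \<beta> h k) \<beta> = Poly_Mapping.lookup (monomial_field \<beta> h' k) \<beta>" for k
    by simp
  then show "h = h'"
    by (simp add: monomial_field_def lookup_pscale lookup_monomial fun_eq_iff)
qed simp

lemma br_monomial_field:
  "euler.br (monomial_field \<beta> h) (monomial_field \<gamma> h') =
     monomial_field (\<beta> + \<gamma>) (\<lambda>k. pairing \<gamma> h * h' k - pairing \<beta> h' * h k)"
proof
  fix k
  have "monomial_field \<beta> h i * euler i (monomial_field \<gamma> h' k) - monomial_field \<gamma> h' i * euler i (monomial_field \<beta> h k) =
      pscale (of_nat (Poly_Mapping.lookup \<gamma> i) * h i * h' k - of_nat (Poly_Mapping.lookup \<beta> i) * h' i * h k)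
        (monomial (\<beta> + \<gamma>))" for i
    by (simp add: monomial_field_def euler.frame_pscale euler_monomial pscale_pscale pscale_mult
        pscale_diff_left monomial_add mult_ac)
  then show "euler.br (monomial_field \<beta> h) (monomial_field \<gamma> h') k =
      monomial_field (\<beta> + \<gamma>) (\<lambda>k. pairing \<gamma> h * h' k - pairing \<beta> h' * h k) k"
    unfolding euler.br_def pscale_sum_left[symmetric] monomial_field_def[of "\<beta> + \<gamma>"] pairing_def
    by (simp add: sum_distrib_right sum_subtractf flip: pscale_sum_left)
qed

text \<open>
  Evaluating the derivation rule on \<open>[t\<^sup>\<beta> h, t\<^sup>\<gamma> h']\<close> with \<open>\<langle>\<gamma>, h\<rangle> = \<langle>\<beta>, h'\<rangle> = 0\<close> shows that the matrix
  \<open>M \<beta>\<close> preserves the hyperplane \<open>\<langle>\<gamma>, \<cdot>\<rangle> = 0\<close>, for enough \<open>\<gamma>\<close> to make it scalar; the scalars are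
  additive in \<open>\<beta>\<close>.
\<close>

lemma weight_zero_derivation:
  fixes M :: "('n::finite \<Rightarrow>\<^sub>0 nat) \<Rightarrow> 'n \<Rightarrow> 'n \<Rightarrow> complex"
  defines "\<phi> \<beta> h k \<equiv> \<Sum>j\<in>UNIV. h j * M \<beta> j k"
  assumes der: "\<And>\<beta> \<gamma> h h' k. \<phi> (\<beta> + \<gamma>) (\<lambda>k. pairing \<gamma> h * h' k - pairing \<beta> h' * h k) k =
    pairing \<gamma> (\<phi> \<beta> h) * h' k - pairing \<beta> h' * \<phi> \<beta> h k + (pairing \<gamma> h * \<phi> \<gamma> h' k - pairing \<beta> (\<phi> \<gamma> h') * h k)"
  obtains C where "\<And>\<beta> j k. M \<beta> j k = (if j = k then pairing \<beta> C else 0)"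
proof -
  define e where "e j = (\<lambda>k. if k = j then 1 else (0::complex))" for j :: 'n
  have sum_e: "(\<Sum>l\<in>UNIV. (a * e j l + b * e k l) * x l) = a * x j + b * x k" for a b j k and x :: "'n \<Rightarrow> complex"
    by (simp add: e_def distrib_right sum.distrib if_distrib[of "\<lambda>x. _ * x"]
        if_distrib[of "\<lambda>x. x * _"] cong: if_cong)
  have pairing_e: "pairing \<beta> (\<lambda>l. a * e j l + b * e k l) =
      a * of_nat (Poly_Mapping.lookup \<beta> j) + b * of_nat (Poly_Mapping.lookup \<beta> k)" for \<beta> a b j k
    using sum_e[of a j b k "\<lambda>l. of_nat (Poly_Mapping.lookup \<beta> l)"] by (simp add: pairing_def mult.commute)
  have \<phi>_e: "\<phi> \<beta> (\<lambda>l. a * e j l + b * e k l) l = a * M \<beta> j l + b * M \<beta> k l" for \<beta> a b j k l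
    by (simp add: \<phi>_def sum_e)
  have quad: "of_nat y * (M \<beta> j j - M \<beta> k k) - M \<beta> k j + of_nat y ^ 2 * M \<beta> j k = 0"
    if "j \<noteq> k" and nondeg: "Poly_Mapping.lookup \<beta> j = 0 \<and> Poly_Mapping.lookup \<beta> k = 0 \<or>
      Poly_Mapping.lookup \<beta> k \<noteq> y * Poly_Mapping.lookup \<beta> j" for \<beta> j k and y :: nat
  proof -
    define \<gamma> where "\<gamma> = unit_exp j + Poly_Mapping.single k y"
    have pairing_\<gamma>: "pairing \<gamma> x = x j + of_nat y * x k" for x
    proof -
      have "of_nat (Poly_Mapping.lookup \<gamma> l) * x l = (1 * e j l + of_nat y * e k l) * x l" for l
        by (auto simp: \<gamma>_def unit_exp_def lookup_add lookup_single e_def)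
      then show ?thesis
        unfolding pairing_def by (simp only: sum_e) simp
    qed
    \<comment> \<open>On the indices \<open>j\<close> and \<open>k\<close> this spans the kernel of
      the pairing with \<gamma>.\<close>
    define h where "h = (\<lambda>l. of_nat y * e j l + (-1) * e k l)"
    have h: "h j = of_nat y" "h k = -1"
      using that(1) by (simp_all add: h_def e_def)
    \<comment> \<open>By \<open>nondeg\<close> the entries of \<beta> at \<open>j\<close> and
      \<open>k\<close> are both zero or not a multiple of \<open>(1, y)\<close>; so a vector on
      these indices can pair to zero with \<beta> but not with \<gamma>.\<close>
    have "\<exists>a b. a * of_nat (Poly_Mapping.lookup \<beta> j) + b * of_nat (Poly_Mapping.lookup \<beta> k) = (0::complex) \<and>
        a + of_nat y * b \<noteq> 0"
    proof (cases "Poly_Mapping.lookup \<beta> j = 0 \<and> Poly_Mapping.lookup \<beta> k = 0")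
      case True
      then show ?thesis
        by (intro exI[of _ 1] exI[of _ 0]) simp
    next
      case False
      then have "of_nat (Poly_Mapping.lookup \<beta> k) \<noteq> (of_nat (y * Poly_Mapping.lookup \<beta> j) :: complex)"
        using nondeg by (metis of_nat_eq_iff)
      then show ?thesis
        by (intro exI[of _ "of_nat (Poly_Mapping.lookup \<beta> k)"]
            exI[of _ "- of_nat (Poly_Mapping.lookup \<beta> j)"]) simp
    qed
    then obtain a b where ab: "a * of_nat (Poly_Mapping.lookup \<beta> j) + b * of_nat (Poly_Mapping.lookup \<beta> k) = (0::complex)"
      "a + of_nat y * b \<noteq> 0"
      by blast
    define h' where "h' = (\<lambda>l. a * e j l + b * e k l)"
    have h': "h' j = a" "h' k = b"
      using that(1) by (simp_all add: h'_def e_def)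
    have "pairing \<gamma> h = 0" "pairing \<beta> h' = 0"
      using ab(1) by (simp_all add: pairing_\<gamma> h pairing_e h'_def)
    \<comment> \<open>With these pairings zero, the left side of \<open>der\<close> is the image of
      the zero vector.\<close>
    then have eq: "pairing \<gamma> (\<phi> \<beta> h) * h' l = pairing \<beta> (\<phi> \<gamma> h') * h l" for l
      using der[of \<beta> \<gamma> h h' l] by (simp add: \<phi>_def)
    \<comment> \<open>Pairing \<open>eq\<close> with \<gamma> kills the right side, as
      \<open>h\<close> lies in the kernel, and leaves a nonzero factor on the left.\<close>
    have "pairing \<gamma> (\<phi> \<beta> h) * (a + of_nat y * b) =
        pairing \<gamma> (\<phi> \<beta> h) * h' j + of_nat y * (pairing \<gamma> (\<phi> \<beta> h) * h' k)"
      by (simp add: h' algebra_simps)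
    also have "\<dots> = 0"
      unfolding eq by (simp add: h)
    finally have "pairing \<gamma> (\<phi> \<beta> h) * (a + of_nat y * b) = 0" .
    then have "pairing \<gamma> (\<phi> \<beta> h) = 0"
      using ab(2) by simp
    then show ?thesis
      unfolding pairing_\<gamma> h_def \<phi>_e by (simp add: algebra_simps power2_eq_square)
  qed
  have scalar: "M \<beta> j k = 0 \<and> M \<beta> j j = M \<beta> k k" if "j \<noteq> k" for \<beta> j k
  proof -
    let ?Q = "\<lambda>y. of_nat y * (M \<beta> j j - M \<beta> k k) - M \<beta> k j + of_nat y ^ 2 * M \<beta> j k = 0"
    \<comment> \<open>Only the quotient of the entries of \<beta> at \<open>k\<close> and
      \<open>j\<close> can be an excluded value of \<open>y\<close>.\<close>
    have "\<exists>y0. \<forall>y. y \<noteq> y0 \<longrightarrow> ?Q y"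
    proof (cases "\<exists>y0. Poly_Mapping.lookup \<beta> k = y0 * Poly_Mapping.lookup \<beta> j")
      case True
      then obtain y0 where "Poly_Mapping.lookup \<beta> k = y0 * Poly_Mapping.lookup \<beta> j"
        by blast
      then have "?Q y" if "y \<noteq> y0" for y
        using that by (intro quad[OF \<open>j \<noteq> k\<close>]) auto
      then show ?thesis
        by blast
    next
      case False
      then have "?Q y" for y
        by (intro quad[OF that]) blast
      then show ?thesis
        by blast
    qed
    then obtain y0 where Q: "\<And>y. y \<noteq> y0 \<Longrightarrow> ?Q y"
      by blast
    define A D where "A = M \<beta> j j - M \<beta> k k" and "D = M \<beta> j k"
    have diff: "A + (of_nat x + of_nat y) * D = 0" if "x \<noteq> y0" "y \<noteq> y0" "x \<noteq> y" for x y
    proof -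
      have "(of_nat x - of_nat y) * (A + (of_nat x + of_nat y) * D) =
          (of_nat x * A - M \<beta> k j + of_nat x ^ 2 * D) - (of_nat y * A - M \<beta> k j + of_nat y ^ 2 * D)"
        by (simp add: algebra_simps power2_eq_square)
      also have "\<dots> = 0"
        unfolding A_def D_def Q[OF that(1)] Q[OF that(2)] by simp
      finally have "(of_nat x - of_nat y) * (A + (of_nat x + of_nat y) * D) = 0" .
      then show ?thesis
        using that(3) by simp
    qed
    \<comment> \<open>The values \<open>y0 + 1\<close>, \<open>y0 + 2\<close>, \<open>y0 + 3\<close>
      avoid \<open>y0\<close>, and two of their pairwise sums differ by one, which isolates
      \<open>D\<close>.\<close>
    have "D = (A + (of_nat (y0 + 1) + of_nat (y0 + 3)) * D) - (A + (of_nat (y0 + 1) + of_nat (y0 + 2)) * D)"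
      by (simp add: algebra_simps)
    also have "\<dots> = 0"
      using diff[of "y0 + 1" "y0 + 2"] diff[of "y0 + 1" "y0 + 3"] by simp
    finally have "A = 0 \<and> D = 0"
      using diff[of "y0 + 1" "y0 + 2"] by simp
    then show ?thesis
      by (simp add: A_def D_def)
  qed
  \<comment> \<open>\<open>undefined\<close> stands for an arbitrary index; all diagonal entries
    agree.\<close>
  define c where "c \<beta> = M \<beta> undefined undefined" for \<beta>
  have M: "M \<beta> j k = (if j = k then c \<beta> else 0)" for \<beta> j k
    using scalar[of j k \<beta>] scalar[of j undefined \<beta>] by (auto simp: c_def)
  have \<phi>: "\<phi> \<beta> h = (\<lambda>k. c \<beta> * h k)" for \<beta> h
    by (rule ext) (simp add: \<phi>_def M if_distrib[of "\<lambda>x. _ * x"] cong: if_cong)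
  have add: "c (\<beta> + \<gamma>) = c \<beta> + c \<gamma>" if "Poly_Mapping.lookup \<beta> i \<noteq> Poly_Mapping.lookup \<gamma> i" for \<beta> \<gamma> i
  proof -
    have pe: "pairing \<beta> (e i) = of_nat (Poly_Mapping.lookup \<beta> i)" for \<beta>
      using pairing_e[of \<beta> 1 i 0 i] by simp
    have pc: "pairing \<beta> (\<lambda>k. a * e i k) = a * of_nat (Poly_Mapping.lookup \<beta> i)" for \<beta> a
      using pairing_e[of \<beta> a i 0 i] by simp
    \<comment> \<open>The bracket of the two fields in direction \<open>e i\<close> carries the
      difference of the \<open>i\<close>-th entries, which can be cancelled.\<close>
    have "c (\<beta> + \<gamma>) * (of_nat (Poly_Mapping.lookup \<gamma> i) - of_nat (Poly_Mapping.lookup \<beta> i)) =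
        (c \<beta> + c \<gamma>) * (of_nat (Poly_Mapping.lookup \<gamma> i) - of_nat (Poly_Mapping.lookup \<beta> i))"
      using der[of \<beta> \<gamma> "e i" "e i" i] unfolding \<phi> pe pc
      by (simp add: e_def algebra_simps del: mult_cancel_left mult_cancel_right)
    moreover have "of_nat (Poly_Mapping.lookup \<gamma> i) - of_nat (Poly_Mapping.lookup \<beta> i) \<noteq> (0::complex)"
      using that by simp
    ultimately show ?thesis
      by (metis mult_right_cancel)
  qed
  have double: "c (\<gamma> + \<gamma>) = c \<gamma> + c \<gamma>" if "Poly_Mapping.lookup \<gamma> i \<noteq> 0" for \<gamma> i
  proof -
    \<comment> \<open>\<open>add\<close> does not apply to two equal exponents. Splitting five
      copies of \<gamma> as four plus one and as three plus two determines the value at two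
      copies.\<close>
    have "c (\<gamma> + \<gamma> + \<gamma>) = c (\<gamma> + \<gamma>) + c \<gamma>"
      "c (\<gamma> + \<gamma> + \<gamma> + \<gamma>) = c (\<gamma> + \<gamma> + \<gamma>) + c \<gamma>"
      "c (\<gamma> + \<gamma> + \<gamma> + \<gamma> + \<gamma>) = c (\<gamma> + \<gamma> + \<gamma> + \<gamma>) + c \<gamma>"
      "c ((\<gamma> + \<gamma> + \<gamma>) + (\<gamma> + \<gamma>)) = c (\<gamma> + \<gamma> + \<gamma>) + c (\<gamma> + \<gamma>)"
      using that by (intro add[of _ i]; simp add: lookup_add)+
    then show ?thesis
      by (simp add: add.assoc)
  qed
  have c0: "c 0 = 0"
    using add[of 0 undefined "unit_exp undefined"] by (simp add: unit_exp_def)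
  have c_add: "c (\<beta> + \<gamma>) = c \<beta> + c \<gamma>" for \<beta> \<gamma>
  proof (cases "\<beta> = \<gamma>")
    case True
    show ?thesis
    proof (cases "\<gamma> = 0")
      case False
      then show ?thesis
        using True double by (metis exponent_nonzeroE)
    qed (simp add: c0 \<open>\<beta> = \<gamma>\<close>)
  next
    case False
    then show ?thesis
      by (metis add poly_mapping_eqI)
  qed
  have c_eq: "c \<beta> = pairing \<beta> (\<lambda>i. c (unit_exp i))" for \<beta>
  proof (induction \<beta> rule: exponent_induct)
    case (unit i \<beta>)
    show ?case
      by (simp add: c_add unit pairing_add pairing_unit_exp)
  qed (simp add: c0 pairing_def)
  have "M \<beta> j k = (if j = k then pairing \<beta> (\<lambda>i. c (unit_exp i)) else 0)" for \<beta> j k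
    by (simp add: M flip: c_eq)
  then show thesis
    by (rule that)
qed

text \<open>Potentials reduce to a derivation \<open>S\<close> that sends the Euler operators into
  the Cartan subalgebra. Comparing weights shows that it kills them and preserves each weight, so it
  acts on weight \<beta> by a matrix \<open>M \<beta>\<close>. This matrix is a scalar additive in
  \<beta>, which is the action of a Cartan element \<open>C\<close>.\<close>

theorem euler_derivation_inner:
  fixes T :: "('n::finite \<Rightarrow> 'n cpoly) \<Rightarrow> 'n \<Rightarrow> 'n cpoly"
  assumes "euler.bracket_derivation T"
  shows "\<exists>Y. \<forall>F. T F = euler.br Y F"
proof -
  have "\<exists>f. \<forall>i. euler i f = T (along i 1) j - pscale (Poly_Mapping.lookup (T (along i 1) j) 0) 1" for j
    using euler_potential[of "\<lambda>i. T (along i 1) j"]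
      euler.bracket_derivation_frame_commute[OF assms] by metis
  then obtain f where f: "\<And>i j. euler i (f j) =
      T (along i 1) j - pscale (Poly_Mapping.lookup (T (along i 1) j) 0) 1"
    by metis
  define S where "S = (\<lambda>F. T F + euler.br f F)"
  define c where "c i j = Poly_Mapping.lookup (T (along i 1) j) 0" for i j
  have S: "euler.bracket_derivation S"
    unfolding S_def by (intro euler.bracket_derivation_add assms euler.bracket_derivation_br)
  then have linS: "lin S" and derS: "S (euler.br F G) = euler.br (S F) G + euler.br F (S G)" for F G
    by (simp_all add: euler.bracket_derivation_def)
  have S_along: "S (along i 1) = monomial_field 0 (c i)" for i
    by (simp add: S_def euler.br_along_one_right f fun_eq_iff monomial_field_def c_def)
  have along_eq: "along j (monomial \<beta>) = monomial_field \<beta> (\<lambda>k. if k = j then 1 else 0)" for j :: 'n and \<beta>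
    by (auto simp: along_def monomial_field_def pscale_def fun_eq_iff)
  \<comment> \<open>The derivation rule for the bracket of \<open>along i 1\<close> with a monomial
    field, an eigenvector of it, read off at the coefficient \<alpha>.\<close>
  have weight: "of_nat (Poly_Mapping.lookup \<beta> i) * Poly_Mapping.lookup (S (along j (monomial \<beta>)) k) \<alpha> =
      (if k = j \<and> \<alpha> = \<beta> then pairing \<beta> (c i) else 0) +
      of_nat (Poly_Mapping.lookup \<alpha> i) * Poly_Mapping.lookup (S (along j (monomial \<beta>)) k) \<alpha>" for i j k \<alpha> \<beta>
  proof -
    have "euler.br (along i 1) (along j (monomial \<beta>)) =
        along j (pscale (of_nat (Poly_Mapping.lookup \<beta> i)) (monomial \<beta>))"
      unfolding euler.br_along_one_left by (auto simp: along_def euler_monomial euler.frame_zero)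
    then have "pscale (of_nat (Poly_Mapping.lookup \<beta> i)) (S (along j (monomial \<beta>)) k) =
        euler.br (monomial_field 0 (c i)) (along j (monomial \<beta>)) k + euler i (S (along j (monomial \<beta>)) k)"
      using derS[of "along i 1" "along j (monomial \<beta>)"]
      by (simp add: S_along euler.br_along_one_left lin_along_pscale[OF linS, symmetric])
    moreover have "euler.br (monomial_field 0 (c i)) (along j (monomial \<beta>)) k =
        pscale (if k = j then pairing \<beta> (c i) else 0) (monomial \<beta>)"
      unfolding along_eq br_monomial_field by (simp add: monomial_field_def pairing_def)
    ultimately have "Poly_Mapping.lookup (pscale (of_nat (Poly_Mapping.lookup \<beta> i)) (S (along j (monomial \<beta>)) k)) \<alpha> =
        Poly_Mapping.lookup (pscale (if k = j then pairing \<beta> (c i) else 0) (monomial \<beta>) +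
          euler i (S (along j (monomial \<beta>)) k)) \<alpha>"
      by simp
    then show ?thesis
      by (auto simp: lookup_add lookup_euler lookup_pscale lookup_monomial)
  qed
  have "c i m = 0" for i m
  proof -
    \<comment> \<open>With \<open>k = j\<close> and equal exponents the two outer terms of
      \<open>weight\<close> coincide, leaving the pairing.\<close>
    have "pairing (unit_exp m) (c i) = 0"
      using weight[of "unit_exp m" i j j "unit_exp m" for j] by simp
    then show ?thesis
      by (simp add: pairing_unit_exp)
  qed
  then have "pairing \<beta> (c i) = 0" for \<beta> i
    by (simp add: pairing_def)
  then have weight_eq: "of_nat (Poly_Mapping.lookup \<beta> i) * Poly_Mapping.lookup (S (along j (monomial \<beta>)) k) \<alpha> =
      of_nat (Poly_Mapping.lookup \<alpha> i) * Poly_Mapping.lookup (S (along j (monomial \<beta>)) k) \<alpha>" for i j k \<alpha> \<beta>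
    using weight[of \<beta> i j k \<alpha>] by simp
  define M where "M \<beta> j k = Poly_Mapping.lookup (S (along j (monomial \<beta>)) k) \<beta>" for \<beta> j k
  \<comment> \<open>An exponent other than \<beta> differs from it in some entry \<open>i\<close>,
    and \<open>weight_eq\<close> for this \<open>i\<close> makes its coefficient zero.\<close>
  have S_single: "S (along j (monomial \<beta>)) k = pscale (M \<beta> j k) (monomial \<beta>)" for \<beta> j k
  proof (rule poly_mapping_eqI)
    fix \<alpha>
    show "Poly_Mapping.lookup (S (along j (monomial \<beta>)) k) \<alpha> =
        Poly_Mapping.lookup (pscale (M \<beta> j k) (monomial \<beta>)) \<alpha>"
    proof (cases "\<alpha> = \<beta>")
      case False
      then obtain i where "Poly_Mapping.lookup \<beta> i \<noteq> Poly_Mapping.lookup \<alpha> i"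
        by (metis poly_mapping_eqI)
      then show ?thesis
        using weight_eq[of \<beta> i j k \<alpha>] False by (simp add: lookup_pscale lookup_monomial)
    qed (simp add: M_def lookup_pscale lookup_monomial)
  qed
  define \<phi> where "\<phi> \<beta> h k = (\<Sum>j\<in>UNIV. h j * M \<beta> j k)" for \<beta> h k
  have S_field: "S (monomial_field \<beta> h) = monomial_field \<beta> (\<phi> \<beta> h)" for \<beta> h
  proof
    fix k
    show "S (monomial_field \<beta> h) k = monomial_field \<beta> (\<phi> \<beta> h) k"
      by (simp add: lin_decompose[OF linS, of "monomial_field \<beta> h"])
        (simp add: monomial_field_def lin_along_pscale[OF linS] S_single pscale_pscale pscale_sum_left \<phi>_def)
  qed
  have field_add: "monomial_field \<beta> h + monomial_field \<beta> h' = monomial_field \<beta> (\<lambda>k. h k + h' k)" for \<beta> and h h' :: "'n \<Rightarrow> complex"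
    by (simp add: monomial_field_def fun_eq_iff pscale_add_left)
  have "\<phi> (\<beta> + \<gamma>) (\<lambda>k. pairing \<gamma> h * h' k - pairing \<beta> h' * h k) =
    (\<lambda>k. pairing \<gamma> (\<phi> \<beta> h) * h' k - pairing \<beta> h' * \<phi> \<beta> h k + (pairing \<gamma> h * \<phi> \<gamma> h' k - pairing \<beta> (\<phi> \<gamma> h') * h k))"
    for \<beta> \<gamma> h h'
    using derS[of "monomial_field \<beta> h" "monomial_field \<gamma> h'"]
    unfolding br_monomial_field S_field field_add monomial_field_inject .
  then obtain C where C: "\<And>\<beta> j k. M \<beta> j k = (if j = k then pairing \<beta> C else 0)"
    using weight_zero_derivation[of M] unfolding \<phi>_def by metis
  have "S (along j (monomial \<beta>)) = euler.br (monomial_field 0 C) (along j (monomial \<beta>))" for j \<beta>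
    unfolding along_eq br_monomial_field
    by (simp add: fun_eq_iff S_single[unfolded along_eq] C) (simp add: monomial_field_def pairing_def)
  then have "S F = euler.br (monomial_field 0 C) F" for F
    by (rule lin_eqI[OF linS euler.br_lin])
  then have "T F = euler.br (monomial_field 0 C - f) F" for F
    unfolding euler.br_diff_left by (simp add: S_def algebra_simps flip: add_diff_eq)
  then show ?thesis
    by blast
qed

theorem theorem4p1:
  shows "(\<forall>\<Delta> :: 'n::finite poly_op \<Rightarrow> 'n poly_op.
            W_plus.local_derivation \<Delta> \<longrightarrow> W_plus.derivation \<Delta>) \<and>
         (\<forall>\<Delta> :: 'n::finite poly_op \<Rightarrow> 'n poly_op.
            W_plus_plus.local_derivation \<Delta> \<longrightarrow> W_plus_plus.derivation \<Delta>)"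
proof (intro conjI allI impI)
  fix \<Delta> :: "'n poly_op \<Rightarrow> 'n poly_op"
  show "W_plus.derivation \<Delta>" if "W_plus.local_derivation \<Delta>"
    by (rule partial.local_derivation_imp_derivation
        [OF W_plus_eq_range W_plus.lie_algebra_axioms partial_derivation_inner that])
  show "W_plus_plus.derivation \<Delta>" if "W_plus_plus.local_derivation \<Delta>"
    by (rule euler.local_derivation_imp_derivation
        [OF W_plus_plus_eq_range W_plus_plus.lie_algebra_axioms euler_derivation_inner that])
qed

end
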